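(* Let $d\in\mathbb N$, $d\ge 2$, let $X$ be a random vector with values in $\mathbb R^d$ with $\mathrm E(|X|^2)<\infty$, expectation vector $\mu=\mathrm E(X)$ and positive definite covariance matrix $\Sigma=\mathrm{Cov}(X)$. Let $I$ be a random vector with values in $\{0,1\}^d$, independent of $X$, with probability mass function $p(a)=P(I=a)$, $a\in\{0,1\}^d$, satisfying $p(\mathbf 1_d)>0$, where $\mathbf 1_d=(1,\dots,1)$. Let $(I_i,I_i\odot X_i)$, $i=1,\dots,n$, be independent random variables with the same distribution as $(I,I\odot X)$. Let $\widehat\mu_n$, $\widehat\Sigma_n$ and $\widehat p_n$ be the estimators defined in the context, where $\widehat p_n$ is the estimator belonging to whichever of the cases (a), (b), (c), (d) of the missingness family $\mathfrak L_I$ is considered, with $\mathcal L(I)\in\mathfrak L_I$. Then the following hold. (1) As $n\to\infty$, $\widehat\mu_n\to\mu$ almost surely, $\widehat\Sigma_n\to\Sigma$ almost surely, and $\widehat p_n(a)\to p(a)$ almost surely for all $a\in\{0,1\}^d$. (2) There exist measurable maps $l_\mu:\mathbb R^d\times\mathbb R^d\to\mathbb R^d$, $l_\Sigma:\mathbb R^d\times\mathbb R^d\to\mathbb R^{d\times d}$ and, for every $a\in\{0,1\}^d$, $l_{p(a)}:\mathbb R^d\times\mathbb R^d\to\mathbb R$, such that each $l\in\{l_\mu,l_\Sigma\}\cup\{l_{p(a)}:a\in\{0,1\}^d\}$ satisfies $\mathrm E(|l(I,I\odot X)|^2)<\infty$ and $\mathrm E(l(I,I\odot X))=0$, and such that,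 as $n\to\infty$, $$\sqrt n(\widehat\mu_n-\mu)=\frac1{\sqrt n}\sum_{i=1}^n l_\mu(I_i,I_i\odot X_i)+o_P(1),$$ $$\sqrt n(\widehat\Sigma_n-\Sigma)=\frac1{\sqrt n}\sum_{i=1}^n l_\Sigma(I_i,I_i\odot X_i)+o_P(1),$$ $$\sqrt n(\widehat p_n(a)-p(a))=\frac1{\sqrt n}\sum_{i=1}^n l_{p(a)}(I_i,I_i\odot X_i)+o_P(1)\quad\text{for all }a\in\{0,1\}^d.$$ (3) With respect to translations $x\mapsto x+c$, $c\in\mathbb R^d$, applied to $X_1,\dots,X_n$, the estimator $\widehat\mu_n$ is translation equivariant, and the estimators $\widehat\Sigma_n$ and $\widehat p_n$ are translation invariant.
   Context: Notation: vectors are column vectors, $x=(x(1),\dots,x(d))^\top$; $|\cdot|$ is the Euclidean norm (also for matrices, entrywise); $\odot$ is the Hadamard (entrywise) product and $^{\odot-1}$ the entrywise inverse, with the conventions $1/0=\infty$ and $0\cdot\infty=0$. $\mathcal L(\cdot)$ denotes the distribution; $\mathbf 1\{\cdot\}$ denotes the indicator. $o_P(1)$ denotes a term converging to $0$ in probability. $I(j)=1$ means that $X(j)$ is observed. Estimator of $\mu$: $\widehat\mu_n=\big(\sum_{i=1}^n I_i\odot X_i\big)\odot\big(\sum_{i=1}^n I_i\big)^{\odot-1}$. Estimator of $\Sigma$: let $\widehat\Lambda_n=\frac1n\sum_{i=1}^n(I_i\odot(X_i-\widehat\mu_n))(I_i\odot(X_i-\widehat\mu_n))^\top$, $\widehat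 M_n=\frac1n\sum_{i=1}^n I_iI_i^\top$, $\widehat S_n=\widehat\Lambda_n\odot\widehat M_n^{\odot-1}$ and $\widehat\Sigma_n=\sqrt{\widehat S_n\widehat S_n}$, the unique positive semidefinite square root of the symmetric positive semidefinite matrix $\widehat S_n\widehat S_n$. Missingness families and estimators of $p$: $\mathfrak L_I$ is a known nonempty family of distributions on $\{0,1\}^d$ with $\mathcal L(I)\in\mathfrak L_I$. The cases are: (a) $\mathfrak L_I$ has exactly one element (the distribution of $I$ is known); then $\widehat p_n(a)=p(a)$. (b) $\mathfrak L_I$ consists of all distributions on $\{0,1\}^d$; then $\widehat p_n(a)=\frac1n\sum_{i=1}^n\mathbf 1\{I_i=a\}$. (c) $\mathfrak L_I$ consists of all distributions of random vectors in $\{0,1\}^d$ with independent and identically (Bernoulli) distributed components; then $\widehat p_n(a)=\widehat q_n^{\sum_{j=1}^d a(j)}(1-\widehat q_n)^{d-\sum_{j=1}^d a(j)}$ with $\widehat q_n=\frac1n\sum_{i=1}^n\frac1d\sum_{j=1}^d\mathbf 1\{I_i(j)=1\}$. (d) $\mathfrak L_I$ consists of all distributions of random vectors in $\{0,1\}^d$ with the monotone missingness property $I(j)=0\Rightarrow I(j)=\cdots=I(d)=0$ for $j=1,\dots,d$; then $\widehat p_n$ is the same estimator as in case (b). Translation equivariance of $\widehat\mu_n$ means that replacing $X_1,\dots,X_n$ by $X_1+c,\dots,X_n+c$ replaces $\widehat\mu_n$ by $\widehat\mu_n+c$; translation invariance means that the estimator is unchanged by this replacement.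
   Formalization: E(|l_Σ(I,I⊙X)|²)<∞ is claimed only if E(|X|⁴)<∞ (otherwise it can fail; l_Σ is still integrable and centred, with the expansion); translation equivariance of μ̂_n is claimed for components observed at least once, and almost surely in full for all large n. *)

theory Defs
  imports "HOL-Probability.Probability"
begin

text \<open>
  Vectors in \<open>\<real>\<^sup>d\<close> are elements of \<^typ>\<open>real ^ 'd\<close>, where the index type is finite and
  linearly ordered, so that it stands for \<open>{1, \<dots>, d}\<close>; the order matters only for monotone
  missingness. On \<^typ>\<open>real ^ 'd\<close> and \<^typ>\<open>real ^ 'd ^ 'd\<close> the library product \<open>*\<close> is
  the entrywise (Hadamard) product, \<open>1\<close> is the all-ones vector, and \<^const>\<open>norm\<close> is the
  Euclidean norm, respectively the Frobenius norm. The matrix product is \<open>**\<close>.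
  Samples are sequences indexed from 0, so the first \<open>n\<close> observations have indices \<open>i < n\<close>.
\<close>

type_synonym 'd rvec = "real ^ 'd"
type_synonym 'd rmat = "real ^ 'd ^ 'd"

definition cube :: "(real ^ 'd::finite) set" where
  "cube = {a. \<forall>j. a $ j \<in> {0, 1}}"

definition outer :: "real ^ 'd::finite \<Rightarrow> real ^ 'd ^ 'd" where
  "outer u = (\<chi> j k. u $ j * u $ k)"

text \<open>
  Entrywise inverses use \<open>inverse 0 = 0\<close> instead of \<open>1/0 = \<infinity>\<close>. In the estimators below a
  vanishing denominator always comes with a vanishing numerator, and then the product is 0 under
  this convention as well as under \<open>0 * \<infinity> = 0\<close>.
\<close>

definition vec_hinv :: "real ^ 'd::finite \<Rightarrow> real ^ 'd" where
  "vec_hinv u = (\<chi> j. inverse (u $ j))"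

definition mat_hinv :: "real ^ 'd::finite ^ 'd \<Rightarrow> real ^ 'd ^ 'd" where
  "mat_hinv A = (\<chi> j k. inverse (A $ j $ k))"

definition pos_semidef :: "real ^ 'd::finite ^ 'd \<Rightarrow> bool" where
  "pos_semidef A \<longleftrightarrow> transpose A = A \<and> (\<forall>x. 0 \<le> x \<bullet> (A *v x))"

definition pos_def :: "real ^ 'd::finite ^ 'd \<Rightarrow> bool" where
  "pos_def A \<longleftrightarrow> transpose A = A \<and> (\<forall>x. x \<noteq> 0 \<longrightarrow> 0 < x \<bullet> (A *v x))"

definition psd_sqrt :: "real ^ 'd::finite ^ 'd \<Rightarrow> real ^ 'd ^ 'd" where
  "psd_sqrt A = (THE R. pos_semidef R \<and> R ** R = A)"

definition cov_mat :: "'w measure \<Rightarrow> ('w \<Rightarrow> real ^ 'd::finite) \<Rightarrow> real ^ 'd ^ 'd" where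
  "cov_mat M X =
     (\<chi> j k. integral\<^sup>L M (\<lambda>\<omega>. (X \<omega> $ j - integral\<^sup>L M (\<lambda>\<omega>. X \<omega> $ j)) *
                               (X \<omega> $ k - integral\<^sup>L M (\<lambda>\<omega>. X \<omega> $ k))))"

text \<open>
  Convergence to 0 in probability, in the form that needs no measurability of \<open>Y n\<close>: the events
  \<open>{\<bar>Y n\<bar> > \<epsilon>}\<close> are covered by measurable sets whose probabilities tend to 0. For measurable
  \<open>Y n\<close> this is \<open>P (\<bar>Y n\<bar> > \<epsilon>) \<longlonglongrightarrow> 0\<close>; for non-measurable \<open>Y n\<close> the latter formula would be
  meaningless, since \<^const>\<open>measure\<close> is 0 outside the sigma-algebra.
\<close>

definition small_in_prob :: "'w measure \<Rightarrow> (nat \<Rightarrow> 'w \<Rightarrow> 'b::real_normed_vector) \<Rightarrow> bool" where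
  "small_in_prob M Y \<longleftrightarrow>
     (\<forall>\<epsilon>>0. \<exists>A. (\<forall>n. A n \<in> sets M \<and> {\<omega> \<in> space M. norm (Y n \<omega>) > \<epsilon>} \<subseteq> A n) \<and>
                (\<lambda>n. measure M (A n)) \<longlonglongrightarrow> 0)"


type_synonym 'd sample = "nat \<Rightarrow> real ^ 'd"

text \<open>
  A component that is never observed among the first \<open>n\<close> observations has the estimate
  \<open>0 * \<infinity> = 0\<close>, which does not move under translations of the data.
\<close>

definition mu_hat :: "'d sample \<Rightarrow> 'd sample \<Rightarrow> nat \<Rightarrow> real ^ 'd::finite" where
  "mu_hat Is Xs n = (\<Sum>i<n. Is i * Xs i) * vec_hinv (\<Sum>i<n. Is i)"

definition Lambda_hat :: "'d sample \<Rightarrow> 'd sample \<Rightarrow> nat \<Rightarrow> real ^ 'd::finite ^ 'd" where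
  "Lambda_hat Is Xs n = (1 / real n) *\<^sub>R (\<Sum>i<n. outer (Is i * (Xs i - mu_hat Is Xs n)))"

definition M_hat :: "'d sample \<Rightarrow> nat \<Rightarrow> real ^ 'd::finite ^ 'd" where
  "M_hat Is n = (1 / real n) *\<^sub>R (\<Sum>i<n. outer (Is i))"

definition S_hat :: "'d sample \<Rightarrow> 'd sample \<Rightarrow> nat \<Rightarrow> real ^ 'd::finite ^ 'd" where
  "S_hat Is Xs n = Lambda_hat Is Xs n * mat_hinv (M_hat Is n)"

definition Sigma_hat :: "'d sample \<Rightarrow> 'd sample \<Rightarrow> nat \<Rightarrow> real ^ 'd::finite ^ 'd" where
  "Sigma_hat Is Xs n = psd_sqrt (S_hat Is Xs n ** S_hat Is Xs n)"


definition cube_laws :: "(real ^ 'd::finite) measure set" where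
  "cube_laws = {P. prob_space P \<and> sets P = sets (count_space cube)}"

definition iid_laws :: "(real ^ 'd::finite) measure set" where
  "iid_laws = {P \<in> cube_laws.
     prob_space.indep_vars P (\<lambda>_. count_space {0, 1}) (\<lambda>j a. a $ j) UNIV \<and>
     (\<forall>j k. distr P (count_space {0, 1}) (\<lambda>a. a $ j) = distr P (count_space {0, 1}) (\<lambda>a. a $ k))}"

definition monotone_laws :: "(real ^ 'd::{finite,linorder}) measure set" where
  "monotone_laws = {P \<in> cube_laws. AE a in P. \<forall>j k. j \<le> k \<longrightarrow> a $ j = 0 \<longrightarrow> a $ k = 0}"

text \<open>
  All estimators of \<open>p\<close> formally receive the whole sample \<open>(Is, Xs)\<close>, although they use at most
  the missingness indicators.
\<close>

type_synonym 'd p_estimator = "'d sample \<Rightarrow> 'd sample \<Rightarrow> nat \<Rightarrow> real ^ 'd \<Rightarrow> real"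

definition p_hat_known :: "(real ^ 'd::finite) measure \<Rightarrow> 'd p_estimator" where
  "p_hat_known P Is Xs n a = measure P {a}"

definition p_hat_freq :: "('d::finite) p_estimator" where
  "p_hat_freq Is Xs n a = (1 / real n) * (\<Sum>i<n. of_bool (Is i = a))"

definition q_hat :: "'d::finite sample \<Rightarrow> nat \<Rightarrow> real" where
  "q_hat Is n = (1 / real n) * (\<Sum>i<n. (1 / real CARD('d)) * (\<Sum>j\<in>UNIV. of_bool (Is i $ j = 1)))"

text \<open>For \<open>a\<close> in the cube, \<open>\<Sum>\<^sub>j a(j)\<close> is the number of components equal to 1.\<close>

definition p_hat_iid :: "('d::finite) p_estimator" where
  "p_hat_iid Is Xs n a =
     q_hat Is n ^ card {j. a $ j = 1} * (1 - q_hat Is n) ^ (CARD('d) - card {j. a $ j = 1})"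

definition missingness_case ::
    "(real ^ 'd::{finite,linorder}) measure set \<Rightarrow> 'd p_estimator \<Rightarrow> bool" where
  "missingness_case \<L> p_hat \<longleftrightarrow>
     (\<exists>P \<in> cube_laws. \<L> = {P} \<and> p_hat = p_hat_known P) \<or>
     (\<L> = cube_laws \<and> p_hat = p_hat_freq) \<or>
     (\<L> = iid_laws \<and> p_hat = p_hat_iid) \<or>
     (\<L> = monotone_laws \<and> p_hat = p_hat_freq)"

end

theory Submission
  imports Defs
begin

text \<open>
  All estimators are smooth functions of empirical means of functions of the observed pairs
  \<open>Z\<^sub>i = (I\<^sub>i, I\<^sub>i \<odot> X\<^sub>i)\<close>, which are independent copies of \<open>(I, I \<odot> X)\<close>. Consistency is therefore a
  matter of the strong law of large numbers, and the linearizations come from one principle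
  (\<open>small_in_prob_sqrt_avg_mult\<close>): if \<open>h\<close> is centred and square integrable and \<open>B\<^sub>n \<rightarrow> 0\<close> almost surely,
  then \<open>\<surd>n (mean of h) B\<^sub>n\<close> tends to 0 in probability, because the first factor has bounded variance.

  The strong law (\<open>avg_tendsto\<close>) is needed under first moments only, since the products
  \<open>X(j) X(k)\<close> are merely integrable. It is obtained by the method of Etemadi: along the geometric
  subsequence \<open>\<lfloor>\<alpha>\<^sup>m\<rfloor>\<close> the summands are truncated at the level \<open>\<alpha>\<^sup>m\<close>; Chebyshev's inequality and
  Borel and Cantelli give convergence there, and monotonicity of the partial sums fills the gaps
  for nonnegative summands.

  A component of \<open>\<mu>\<close> is estimated by a ratio of empirical means, the numerator having
  expectation \<open>\<mu>(j) P(I(j) = 1)\<close> by independence of \<open>I\<close> and \<open>X\<close>. For such ratios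
  \<open>F\<^sub>n / G\<^sub>n\<close> with limit \<open>\<theta>\<close> and \<open>E G\<^sub>n = m\<close> one has, up to negligible terms,
  \<open>F\<^sub>n / G\<^sub>n - \<theta> = (F\<^sub>n - \<theta> G\<^sub>n) / m\<close> (\<open>asymp_linear_ratio\<close>); the error is the product of
  \<open>G\<^sub>n - m\<close>, of order \<open>n\<^sup>-\<^sup>1\<^sup>/\<^sup>2\<close>, and a term that tends to 0 almost surely, so
  that the numerator again needs a first moment only. An entry of \<open>S\<^sub>n\<close> is a ratio of this kind plus
  terms in which the error \<open>\<surd>n (\<mu>\<^sub>n - \<mu>)\<close> is multiplied by empirical means of centred variables;
  these products are negligible too (\<open>S_hat_asymp_linear\<close>).

  The matrix square root causes no further error: \<open>S\<^sub>n\<close> is symmetric and converges to the positive definite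
  \<open>\<Sigma>\<close>, hence is eventually positive definite itself, and then it is the unique positive semidefinite
  root of \<open>S\<^sub>n S\<^sub>n\<close>, so that \<open>\<Sigma>\<^sub>n = S\<^sub>n\<close> (\<open>psd_sqrt_square\<close>, \<open>Sigma_hat_eq_S_hat\<close>). Finally, every
  estimator of \<open>p(a)\<close> is a differentiable function of one empirical mean, to which the delta method
  applies (\<open>asymp_linear_smooth_transform\<close>), and the behaviour under translations is algebra.
\<close>

section \<open>Independent copies and their empirical means\<close>

text \<open>
  Everything that is averaged later is a real function of the observations \<open>Z i\<close>, which take values in
  an arbitrary measurable space; the variable \<open>Z0\<close> carries the common distribution and serves to state
  moment conditions.
\<close>

locale iid_copies = prob_space M for M :: "'w measure" +
  fixes N :: "'z measure" and Z :: "nat \<Rightarrow> 'w \<Rightarrow> 'z" and Z0 :: "'w \<Rightarrow> 'z"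
  assumes Z0_meas [measurable]: "Z0 \<in> measurable M N"
    and indep_Z: "indep_vars (\<lambda>_. N) Z UNIV"
    and distr_Z: "\<And>i. distr M N (Z i) = distr M N Z0"
begin

lemma Z_meas [measurable]: "Z i \<in> measurable M N"
  using indep_Z by (auto simp: indep_vars_def)

lemma integrable_copy:
  fixes f :: "'z \<Rightarrow> real"
  assumes [measurable]: "f \<in> borel_measurable N"
  shows "integrable M (\<lambda>\<omega>. f (Z i \<omega>)) \<longleftrightarrow> integrable M (\<lambda>\<omega>. f (Z0 \<omega>))"
  using integrable_distr_eq[of "Z i" M N f] integrable_distr_eq[of Z0 M N f] by (simp add: distr_Z)

lemma expectation_copy:
  fixes f :: "'z \<Rightarrow> real"
  assumes [measurable]: "f \<in> borel_measurable N"
  shows "expectation (\<lambda>\<omega>. f (Z i \<omega>)) = expectation (\<lambda>\<omega>. f (Z0 \<omega>))"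
  using integral_distr[of "Z i" M N f] integral_distr[of Z0 M N f] by (simp add: distr_Z)

lemma prob_copy:
  assumes [measurable]: "Measurable.pred N P"
  shows "prob {\<omega>\<in>space M. P (Z i \<omega>)} = prob {\<omega>\<in>space M. P (Z0 \<omega>)}"
proof -
  have *: "{\<omega>\<in>space M. P (Z' \<omega>)} = Z' -` {z\<in>space N. P z} \<inter> space M" 
    if "Z' \<in> measurable M N" for Z' using measurable_space[OF that] by auto
  show ?thesis
    using measure_distr[of "Z i" M N "{z\<in>space N. P z}"] measure_distr[of Z0 M N "{z\<in>space N. P z}"]
    by (simp add: distr_Z *)
qed

definition avg :: "('z \<Rightarrow> real) \<Rightarrow> nat \<Rightarrow> 'w \<Rightarrow> real" where
  "avg f n \<omega> = (\<Sum>i<n. f (Z i \<omega>)) / real n"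

lemma avg_meas [measurable]:
  assumes [measurable]: "f \<in> borel_measurable N"
  shows "avg f n \<in> borel_measurable M"
  unfolding avg_def by measurable

lemma avg_diff: "avg (\<lambda>z. f z - g z) n \<omega> = avg f n \<omega> - avg g n \<omega>"
  by (simp add: avg_def sum_subtractf diff_divide_distrib)

lemma avg_cmult: "avg (\<lambda>z. c * f z) n \<omega> = c * avg f n \<omega>"
  by (simp add: avg_def sum_distrib_left)

lemma avg_const: "n > 0 \<Longrightarrow> avg (\<lambda>z. c) n \<omega> = c"
  by (simp add: avg_def)

text \<open>
  Independent centred variables are orthogonal, so the second moment of the sum is additive; in the induction
  the cross term of the new summand with the previous sum vanishes.
\<close>

lemma square_sum_moment:
  fixes f :: "'z \<Rightarrow> real"
  assumes [measurable]: "f \<in> borel_measurable N"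
    and sq: "integrable M (\<lambda>\<omega>. (f (Z0 \<omega>))\<^sup>2)" and zero: "expectation (\<lambda>\<omega>. f (Z0 \<omega>)) = 0"
  shows "integrable M (\<lambda>\<omega>. (\<Sum>i<n. f (Z i \<omega>))\<^sup>2)"
    and "expectation (\<lambda>\<omega>. (\<Sum>i<n. f (Z i \<omega>))\<^sup>2) = real n * expectation (\<lambda>\<omega>. (f (Z0 \<omega>))\<^sup>2)"
proof -
  have f_sq: "integrable M (\<lambda>\<omega>. (f (Z i \<omega>))\<^sup>2)" for i
    using integrable_copy[of "\<lambda>z. (f z)\<^sup>2" i] sq by simp
  have f_int: "integrable M (\<lambda>\<omega>. f (Z i \<omega>))" for i
    using f_sq[of i] by (rule square_integrable_imp_integrable[rotated]) simp
  have "integrable M (\<lambda>\<omega>. (\<Sum>i<n. f (Z i \<omega>))\<^sup>2) \<and>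
    expectation (\<lambda>\<omega>. (\<Sum>i<n. f (Z i \<omega>))\<^sup>2) = real n * expectation (\<lambda>\<omega>. (f (Z0 \<omega>))\<^sup>2)"
  proof (induction n)
    case (Suc n)
    let ?S = "\<lambda>\<omega>. \<Sum>i<n. f (Z i \<omega>)"
    have "indep_vars (\<lambda>_. borel) (\<lambda>i \<omega>. f (Z i \<omega>)) UNIV"
      by (rule indep_vars_compose2[OF indep_Z]) simp
    then have "indep_vars (\<lambda>_. borel) (\<lambda>i \<omega>. f (Z i \<omega>)) (insert n {..<n})"
      by (rule indep_vars_subset) simp
    then have ind: "indep_var borel (\<lambda>\<omega>. f (Z n \<omega>)) borel ?S"
      using indep_vars_sum[of "{..<n}" n "\<lambda>i \<omega>. f (Z i \<omega>)"] by simp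
    have S_int: "integrable M ?S" using f_int by simp
    have cross: "integrable M (\<lambda>\<omega>. f (Z n \<omega>) * ?S \<omega>)" 
      "expectation (\<lambda>\<omega>. f (Z n \<omega>) * ?S \<omega>) = 0"
      using indep_var_integrable[OF ind f_int S_int] indep_var_lebesgue_integral[OF ind f_int S_int]
        expectation_copy[of f n] zero by simp_all
    have eq: "(\<Sum>i<Suc n. f (Z i \<omega>))\<^sup>2 = ((?S \<omega>)\<^sup>2 + 2 * (f (Z n \<omega>) * ?S \<omega>)) + (f (Z n \<omega>))\<^sup>2" for \<omega>
      by (simp add: power2_eq_square algebra_simps)
    show ?case
      unfolding eq using Suc cross f_sq expectation_copy[of "\<lambda>z. (f z)\<^sup>2" n]
      by (simp add: algebra_simps)
  qed simp
  then show "integrable M (\<lambda>\<omega>. (\<Sum>i<n. f (Z i \<omega>))\<^sup>2)"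
    and "expectation (\<lambda>\<omega>. (\<Sum>i<n. f (Z i \<omega>))\<^sup>2) = real n * expectation (\<lambda>\<omega>. (f (Z0 \<omega>))\<^sup>2)"
    by auto
qed

lemma avg_chebyshev_centered:
  fixes f :: "'z \<Rightarrow> real"
  assumes [measurable]: "f \<in> borel_measurable N"
    and sq: "integrable M (\<lambda>\<omega>. (f (Z0 \<omega>))\<^sup>2)" and zero: "expectation (\<lambda>\<omega>. f (Z0 \<omega>)) = 0"
    and a: "a > 0" and n: "n > 0"
  shows "prob {\<omega>\<in>space M. a \<le> \<bar>avg f n \<omega>\<bar>} \<le> expectation (\<lambda>\<omega>. (f (Z0 \<omega>))\<^sup>2) / (real n * a\<^sup>2)"
proof -
  let ?S = "\<lambda>\<omega>. \<Sum>i<n. f (Z i \<omega>)"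
  have f_sq: "integrable M (\<lambda>\<omega>. (f (Z i \<omega>))\<^sup>2)" for i
    using integrable_copy[of "\<lambda>z. (f z)\<^sup>2" i] sq by simp
  have f_int: "integrable M (\<lambda>\<omega>. f (Z i \<omega>))" for i
    using f_sq[of i] by (rule square_integrable_imp_integrable[rotated]) simp
  have ES: "expectation ?S = 0"
    using f_int zero by (simp add: expectation_copy)
  have "prob {\<omega>\<in>space M. a \<le> \<bar>avg f n \<omega>\<bar>} = prob {\<omega>\<in>space M. \<bar>?S \<omega> - expectation ?S\<bar> \<ge> real n * a}"
    unfolding ES avg_def using n by (simp add: abs_divide field_simps)
  also have "\<dots> \<le> variance ?S / (real n * a)\<^sup>2"
    using square_sum_moment(1)[OF _ sq zero] n a by (intro Chebyshev_inequality) auto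
  also have "\<dots> = expectation (\<lambda>\<omega>. (f (Z0 \<omega>))\<^sup>2) / (real n * a\<^sup>2)"
    unfolding ES using square_sum_moment(2)[OF _ sq zero, of n] n a
    by (simp add: power2_eq_square)
  finally show ?thesis .
qed

lemma avg_chebyshev:
  fixes f :: "'z \<Rightarrow> real"
  assumes [measurable]: "f \<in> borel_measurable N"
    and sq: "integrable M (\<lambda>\<omega>. (f (Z0 \<omega>))\<^sup>2)" and a: "a > 0" and n: "n > 0"
  shows "prob {\<omega>\<in>space M. a \<le> \<bar>avg f n \<omega> - expectation (\<lambda>\<omega>. f (Z0 \<omega>))\<bar>}
         \<le> expectation (\<lambda>\<omega>. (f (Z0 \<omega>))\<^sup>2) / (real n * a\<^sup>2)"
proof -
  define m where "m = expectation (\<lambda>\<omega>. f (Z0 \<omega>))"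
  have int: "integrable M (\<lambda>\<omega>. f (Z0 \<omega>))"
    using sq by (rule square_integrable_imp_integrable[rotated]) simp
  have eq: "(f z - m)\<^sup>2 = (f z)\<^sup>2 - 2 * m * f z + m\<^sup>2" for z
    by (simp add: power2_eq_square algebra_simps)
  have sq': "integrable M (\<lambda>\<omega>. (f (Z0 \<omega>) - m)\<^sup>2)"
    unfolding eq using sq int by simp
  have zero: "expectation (\<lambda>\<omega>. f (Z0 \<omega>) - m) = 0" using int by (simp add: m_def prob_space)
  have le: "expectation (\<lambda>\<omega>. (f (Z0 \<omega>) - m)\<^sup>2) \<le> expectation (\<lambda>\<omega>. (f (Z0 \<omega>))\<^sup>2)"
    using variance_eq[OF int sq] by (simp add: m_def)
  have "prob {\<omega>\<in>space M. a \<le> \<bar>avg (\<lambda>z. f z - m) n \<omega>\<bar>}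
        \<le> expectation (\<lambda>\<omega>. (f (Z0 \<omega>) - m)\<^sup>2) / (real n * a\<^sup>2)"
    using sq' zero a n by (intro avg_chebyshev_centered) auto
  also have "\<dots> \<le> expectation (\<lambda>\<omega>. (f (Z0 \<omega>))\<^sup>2) / (real n * a\<^sup>2)"
    using le by (intro divide_right_mono) auto
  finally show ?thesis using n by (simp add: avg_diff avg_const m_def)
qed

end

text \<open>
  The next two bounds control, uniformly in \<open>n\<close>, the two error terms of a truncation at the
  levels \<open>\<alpha>\<^sup>m\<close>. A geometric sum is at most \<open>\<alpha> / (\<alpha> - 1)\<close> times its largest term, and that term is
  below \<open>x\<close> in the first sum.
\<close>

lemma sum_geometric_below:
  fixes \<alpha> x :: real
  assumes "\<alpha> > 1" "x \<ge> 0"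
  shows "(\<Sum>m<n. if \<alpha> ^ m < x then \<alpha> ^ m else 0) \<le> \<alpha> / (\<alpha> - 1) * x"
proof (induction n)
  case 0 then show ?case using assms by simp
next
  case (Suc n)
  show ?case
  proof (cases "\<alpha> ^ n < x")
    case True
    have "(\<Sum>m<Suc n. if \<alpha> ^ m < x then \<alpha> ^ m else 0) \<le> (\<Sum>m<Suc n. \<alpha> ^ m)"
      using assms by (intro sum_mono) auto
    also have "\<dots> = (\<alpha> ^ Suc n - 1) / (\<alpha> - 1)" using assms by (subst geometric_sum) auto
    also have "\<dots> \<le> \<alpha> * \<alpha> ^ n / (\<alpha> - 1)" using assms by (intro divide_right_mono) auto
    also have "\<dots> \<le> \<alpha> * x / (\<alpha> - 1)"
      using True assms by (intro divide_right_mono mult_left_mono) auto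
    finally show ?thesis by simp
  qed (use Suc in simp)
qed

text \<open>
  The largest term has the smallest level \<open>\<alpha>\<^sup>m \<ge> x\<close> and is at most \<open>x\<^sup>2 / x\<close>. The induction avoids
  naming that level: replacing \<open>x\<close> by \<open>x / \<alpha>\<close> shifts the summation index by one.
\<close>

lemma sum_geometric_above:
  fixes \<alpha> x :: real
  assumes "\<alpha> > 1" "x \<ge> 0"
  shows "(\<Sum>m<n. if x \<le> \<alpha> ^ m then x\<^sup>2 / \<alpha> ^ m else 0) \<le> \<alpha> / (\<alpha> - 1) * x"
  using assms(2)
proof (induction n arbitrary: x)
  case 0 then show ?case using assms by simp
next
  case (Suc n)
  show ?case
  proof (cases "x \<le> 1")
    case True
    have "(\<Sum>m<Suc n. if x \<le> \<alpha> ^ m then x\<^sup>2 / \<alpha> ^ m else 0) \<le> (\<Sum>m<Suc n. x\<^sup>2 * (1 / \<alpha>) ^ m)"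
      using assms by (intro sum_mono) (auto simp: power_divide)
    also have "\<dots> = x\<^sup>2 * ((1 - (1 / \<alpha>) ^ Suc n) / (1 - 1 / \<alpha>))"
      unfolding sum_distrib_left[symmetric] using assms by (subst sum_gp_strict) auto
    also have "\<dots> \<le> x\<^sup>2 * (1 / (1 - 1 / \<alpha>))"
      using assms by (intro mult_left_mono divide_right_mono) auto
    also have "1 / (1 - 1 / \<alpha>) = \<alpha> / (\<alpha> - 1)" using assms by (simp add: field_simps)
    also have "x\<^sup>2 * (\<alpha> / (\<alpha> - 1)) \<le> x * (\<alpha> / (\<alpha> - 1))"
      using True Suc.prems assms
      by (intro mult_right_mono) (auto simp: power2_eq_square mult_left_le)
    finally show ?thesis by (simp add: mult.commute)
  next
    case False
    have "(\<Sum>m<Suc n. if x \<le> \<alpha> ^ m then x\<^sup>2 / \<alpha> ^ m else 0)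
        = (\<Sum>m<n. \<alpha> * (if x / \<alpha> \<le> \<alpha> ^ m then (x / \<alpha>)\<^sup>2 / \<alpha> ^ m else 0))"
      unfolding sum.lessThan_Suc_shift using False assms
      by (auto intro!: sum.cong simp: field_simps power2_eq_square)
    also have "\<dots> \<le> \<alpha> * (\<alpha> / (\<alpha> - 1) * (x / \<alpha>))"
      unfolding sum_distrib_left[symmetric] using assms Suc.prems
      by (intro mult_left_mono Suc.IH) auto
    finally show ?thesis using assms by simp
  qed
qed

section \<open>The strong law of large numbers\<close>

text \<open>
  If \<open>\<alpha>\<^sup>m \<le> n < \<alpha>\<^sup>m\<^sup>+\<^sup>1\<close>, monotonicity of \<open>S\<close> confines \<open>S n / n\<close> between the averages at the
  neighbouring points of the subsequence, distorted by factors that tend to \<open>1 / \<alpha>\<close> and \<open>\<alpha>\<close>.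
  Ratios \<open>\<alpha> = 1 + 1 / (j + 1)\<close> arbitrarily close to 1 then leave only one possible limit.
\<close>

lemma LIMSEQ_of_geometric_subsequences:
  fixes S :: "nat \<Rightarrow> real"
  assumes mono: "mono S" and nonneg: "\<And>n. 0 \<le> S n"
    and sub: "\<And>j. (\<lambda>m. S (nat \<lfloor>(1 + 1 / real (Suc j)) ^ m\<rfloor>) / real (nat \<lfloor>(1 + 1 / real (Suc j)) ^ m\<rfloor>)) \<longlonglongrightarrow> L"
  shows "(\<lambda>n. S n / real n) \<longlonglongrightarrow> L"
proof -
  define u where "u \<alpha> n = \<alpha> * (S (nat \<lfloor>\<alpha> ^ Suc (nat \<lfloor>log \<alpha> (real n)\<rfloor>)\<rfloor>) / real (nat \<lfloor>\<alpha> ^ Suc (nat \<lfloor>log \<alpha> (real n)\<rfloor>)\<rfloor>))"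
    for \<alpha> :: real and n
  define l where "l \<alpha> n = (1 / \<alpha> - (1 / \<alpha>) ^ Suc (nat \<lfloor>log \<alpha> (real n)\<rfloor>)) * (S (nat \<lfloor>\<alpha> ^ nat \<lfloor>log \<alpha> (real n)\<rfloor>\<rfloor>) / real (nat \<lfloor>\<alpha> ^ nat \<lfloor>log \<alpha> (real n)\<rfloor>\<rfloor>))"
    for \<alpha> :: real and n
  have bounds: "l \<alpha> n \<le> S n / real n \<and> S n / real n \<le> u \<alpha> n" if \<alpha>: "\<alpha> > 1" and n: "n \<ge> 1" for \<alpha> n
  proof -
    define m where "m = nat \<lfloor>log \<alpha> (real n)\<rfloor>"
    have lg: "0 \<le> log \<alpha> (real n)" using \<alpha> n by simp
    have m: "real m \<le> log \<alpha> (real n)" "log \<alpha> (real n) < real (Suc m)"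
      using lg unfolding m_def by linarith+
    have am: "\<alpha> ^ m \<le> real n"
    proof -
      have "\<alpha> powr real m \<le> real n" using m(1) \<alpha> n by (subst (asm) le_log_iff) auto
      then show ?thesis using \<alpha> by (simp add: powr_realpow)
    qed
    have nm: "real n < \<alpha> ^ Suc m"
    proof -
      have "real n < \<alpha> powr real (Suc m)" using m(2) \<alpha> n by (subst (asm) log_less_iff) auto
      then show ?thesis using \<alpha> by (metis less_trans powr_realpow zero_less_one)
    qed
    define k k' where "k = nat \<lfloor>\<alpha> ^ m\<rfloor>" and "k' = nat \<lfloor>\<alpha> ^ Suc m\<rfloor>"
    have one: "1 \<le> \<alpha> ^ m" "1 \<le> \<alpha> ^ Suc m" using \<alpha> by (auto intro!: one_le_power simp del: power_Suc)
    have k: "1 \<le> k" "k \<le> n" "\<alpha> ^ m - 1 \<le> real k" unfolding k_def using one am by linarith+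
    have k': "n \<le> k'" "real k' \<le> \<alpha> ^ Suc m" unfolding k'_def using one nm by linarith+
    have "S n / real n \<le> S k' / real n"
      using monoD[OF mono k'(1)] by (intro divide_right_mono) auto
    also have "\<dots> = (real k' / real n) * (S k' / real k')" using n k' by (simp add: field_simps)
    also have "\<dots> \<le> \<alpha> * (S k' / real k')"
    proof (intro mult_right_mono)
      have "\<alpha> * \<alpha> ^ m \<le> \<alpha> * real n" using am \<alpha> by (intro mult_left_mono) auto
      then have "real k' \<le> \<alpha> * real n" using k'(2) by simp
      then show "real k' / real n \<le> \<alpha>" using n by (simp add: field_simps)
    qed (use nonneg in auto)
    finally have up: "S n / real n \<le> \<alpha> * (S k' / real k')" .
    have "(1 / \<alpha> - (1 / \<alpha>) ^ Suc m) * (S k / real k) \<le> (real k / real n) * (S k / real k)"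
    proof (intro mult_right_mono)
      have "1 / \<alpha> - (1 / \<alpha>) ^ Suc m = (\<alpha> ^ m - 1) / \<alpha> ^ Suc m"
        using \<alpha> by (simp add: field_simps)
      also have "\<dots> \<le> real k / \<alpha> ^ Suc m" using k \<alpha> by (intro divide_right_mono) auto
      also have "\<dots> \<le> real k / real n" using nm n by (intro divide_left_mono) auto
      finally show "1 / \<alpha> - (1 / \<alpha>) ^ Suc m \<le> real k / real n" .
    qed (use nonneg in auto)
    also have "\<dots> = S k / real n" using k by simp
    also have "\<dots> \<le> S n / real n" using monoD[OF mono k(2)] by (intro divide_right_mono) auto
    finally show ?thesis using up by (simp add: l_def u_def m_def k_def k'_def)
  qed
  have lim: "l (1 + 1 / real (Suc j)) \<longlonglongrightarrow> L / (1 + 1 / real (Suc j))"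
    "u (1 + 1 / real (Suc j)) \<longlonglongrightarrow> (1 + 1 / real (Suc j)) * L" for j
  proof -
    define \<alpha> where "\<alpha> = 1 + 1 / real (Suc j)"
    have \<alpha>: "\<alpha> > 1" by (simp add: \<alpha>_def)
    have "filterlim (\<lambda>n. log \<alpha> (real n)) at_top sequentially"
      using \<alpha> by real_asymp
    then have m: "filterlim (\<lambda>n. nat \<lfloor>log \<alpha> (real n)\<rfloor>) at_top sequentially"
      by (intro filterlim_compose[OF filterlim_nat_sequentially] filterlim_compose[OF filterlim_floor_sequentially])
    have Sm: "filterlim (\<lambda>n. Suc (nat \<lfloor>log \<alpha> (real n)\<rfloor>)) at_top sequentially"
      by (rule filterlim_compose[OF filterlim_Suc m])
    have "(\<lambda>m. (1 / \<alpha>) ^ m) \<longlonglongrightarrow> 0" using \<alpha> by (intro LIMSEQ_power_zero) auto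
    then have p: "(\<lambda>n. (1 / \<alpha>) ^ Suc (nat \<lfloor>log \<alpha> (real n)\<rfloor>)) \<longlonglongrightarrow> 0"
      by (rule filterlim_compose[OF _ Sm])
    have "l \<alpha> \<longlonglongrightarrow> (1 / \<alpha> - 0) * L" unfolding l_def
      by (intro tendsto_mult tendsto_diff tendsto_const p)
        (rule filterlim_compose[OF sub[of j, folded \<alpha>_def] m])
    then show "l (1 + 1 / real (Suc j)) \<longlonglongrightarrow> L / (1 + 1 / real (Suc j))" by (simp add: \<alpha>_def)
    have "u \<alpha> \<longlonglongrightarrow> \<alpha> * L" unfolding u_def
      by (intro tendsto_mult tendsto_const) (rule filterlim_compose[OF sub[of j, folded \<alpha>_def] Sm])
    then show "u (1 + 1 / real (Suc j)) \<longlonglongrightarrow> (1 + 1 / real (Suc j)) * L" by (simp add: \<alpha>_def)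
  qed
  have bd: "eventually (\<lambda>n. l (1 + 1 / real (Suc j)) n \<le> S n / real n \<and> S n / real n \<le> u (1 + 1 / real (Suc j)) n) sequentially" for j
    using eventually_ge_at_top[of 1] by eventually_elim (rule bounds, auto)
  have a1: "(\<lambda>j. L / (1 + 1 / real (Suc j))) \<longlonglongrightarrow> L" by real_asymp
  have a2: "(\<lambda>j. (1 + 1 / real (Suc j)) * L) \<longlonglongrightarrow> L" by real_asymp
  show ?thesis
  proof (rule order_tendstoI)
    fix c assume "c < L"
    then obtain j where "c < L / (1 + 1 / real (Suc j))"
      using order_tendstoD(1)[OF a1] eventually_happens'[OF sequentially_bot] by blast
    from order_tendstoD(1)[OF lim(1) this] bd[of j] show "eventually (\<lambda>n. c < S n / real n) sequentially"
      by eventually_elim auto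
  next
    fix c assume "L < c"
    then obtain j where "(1 + 1 / real (Suc j)) * L < c"
      using order_tendstoD(2)[OF a2] eventually_happens'[OF sequentially_bot] by blast
    from order_tendstoD(2)[OF lim(2) this] bd[of j] show "eventually (\<lambda>n. S n / real n < c) sequentially"
      by eventually_elim auto
  qed
qed

context iid_copies
begin

text \<open>
  The truncation level \<open>\<alpha>\<^sup>m\<close> depends on the index of the subsequence only, not on the summand. The averages
  of the truncated variables deviate from their expectation with a probability bounded by Chebyshev's
  inequality, and truncation changes one of the first \<open>k m \<le> \<alpha>\<^sup>m\<close> summands with probability at most
  \<open>\<alpha>\<^sup>m P(\<bar>f\<bar> > \<alpha>\<^sup>m)\<close>. Summed over \<open>m\<close>, both are bounded by a multiple of the first absolute moment,
  so Borel and Cantelli apply.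
\<close>

lemma avg_geometric_subsequence:
  fixes f :: "'z \<Rightarrow> real" and \<alpha> :: real
  assumes f [measurable]: "f \<in> borel_measurable N"
    and int: "integrable M (\<lambda>\<omega>. f (Z0 \<omega>))" and \<alpha>: "\<alpha> > 1"
  shows "AE \<omega> in M. (\<lambda>m. avg f (nat \<lfloor>\<alpha> ^ m\<rfloor>) \<omega>) \<longlonglongrightarrow> expectation (\<lambda>\<omega>. f (Z0 \<omega>))"
proof -
  define k where "k m = nat \<lfloor>\<alpha> ^ m\<rfloor>" for m
  define g where "g m z = (if \<bar>f z\<bar> \<le> \<alpha> ^ m then f z else 0)" for m z
  have g_meas [measurable]: "g m \<in> borel_measurable N" for m unfolding g_def by measurable
  have pos: "0 < \<alpha> ^ m" for m using \<alpha> by simp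
  have one: "1 \<le> \<alpha> ^ m" for m using \<alpha> by (simp add: one_le_power)
  have k: "1 \<le> k m" "real (k m) \<le> \<alpha> ^ m" "\<alpha> ^ m / 2 \<le> real (k m)" for m
  proof -
    have "\<alpha> ^ m - 1 \<le> real (k m)" using one[of m] unfolding k_def by linarith
    moreover show "1 \<le> k m" using one[of m] unfolding k_def by linarith
    ultimately show "\<alpha> ^ m / 2 \<le> real (k m)" by linarith
    show "real (k m) \<le> \<alpha> ^ m" using one[of m] unfolding k_def by linarith
  qed
  have g_abs: "\<bar>g m z\<bar> \<le> \<alpha> ^ m" for m z using pos[of m] by (auto simp: g_def)
  have g_sq_int: "integrable M (\<lambda>\<omega>. (g m (Z0 \<omega>))\<^sup>2)" for m
  proof (rule integrable_const_bound[of _ "(\<alpha> ^ m)\<^sup>2"])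
    show "AE \<omega> in M. norm ((g m (Z0 \<omega>))\<^sup>2) \<le> (\<alpha> ^ m)\<^sup>2"
    proof (rule AE_I2)
      fix \<omega>
      have "\<bar>g m (Z0 \<omega>)\<bar>\<^sup>2 \<le> (\<alpha> ^ m)\<^sup>2" by (intro power_mono g_abs) simp
      then show "norm ((g m (Z0 \<omega>))\<^sup>2) \<le> (\<alpha> ^ m)\<^sup>2" by simp
    qed
  qed simp
  have t_lim: "(\<lambda>m. expectation (\<lambda>\<omega>. g m (Z0 \<omega>))) \<longlonglongrightarrow> expectation (\<lambda>\<omega>. f (Z0 \<omega>))"
  proof (rule integral_dominated_convergence[where w = "\<lambda>\<omega>. \<bar>f (Z0 \<omega>)\<bar>"])
    show "AE \<omega> in M. (\<lambda>m. g m (Z0 \<omega>)) \<longlonglongrightarrow> f (Z0 \<omega>)"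
    proof (rule AE_I2)
      fix \<omega>
      have "filterlim (\<lambda>m. \<alpha> ^ m) at_top sequentially" using \<alpha> by real_asymp
      then have "eventually (\<lambda>m. \<bar>f (Z0 \<omega>)\<bar> \<le> \<alpha> ^ m) sequentially"
        by (simp add: filterlim_at_top)
      then have "eventually (\<lambda>m. f (Z0 \<omega>) = g m (Z0 \<omega>)) sequentially"
        by eventually_elim (simp add: g_def)
      then show "(\<lambda>m. g m (Z0 \<omega>)) \<longlonglongrightarrow> f (Z0 \<omega>)"
        by (rule Lim_transform_eventually[OF tendsto_const])
    qed
    show "AE \<omega> in M. norm (g m (Z0 \<omega>)) \<le> \<bar>f (Z0 \<omega>)\<bar>" for m
      by (rule AE_I2) (simp add: g_def)
  qed (use int in auto)
  \<comment> \<open>The expectations of these two functions bound the probabilities of a truncation and, up to a constant,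
    of a deviation of the truncated average.\<close>
  define tail where "tail m \<omega> = (if \<alpha> ^ m < \<bar>f (Z0 \<omega>)\<bar> then \<alpha> ^ m else 0)" for m \<omega>
  define head where "head m \<omega> = (if \<bar>f (Z0 \<omega>)\<bar> \<le> \<alpha> ^ m then \<bar>f (Z0 \<omega>)\<bar>\<^sup>2 / \<alpha> ^ m else 0)" for m \<omega>
  have head_eq: "head m \<omega> = (g m (Z0 \<omega>))\<^sup>2 / \<alpha> ^ m" for m \<omega> by (simp add: head_def g_def)
  have tail_int: "integrable M (tail m)" for m
    unfolding tail_def by (rule integrable_const_bound[of _ "\<alpha> ^ m"]) (use pos[of m] in auto)
  have head_int: "integrable M (head m)" for m
    unfolding head_eq[abs_def] using g_sq_int by simp
  have tail_nn: "0 \<le> tail m \<omega>" and head_nn: "0 \<le> head m \<omega>" for m \<omega> 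
    using pos[of m] by (simp_all add: tail_def head_def)
  have sum_bounded: "summable (\<lambda>m. expectation (h m))"
    if h: "\<And>m. integrable M (h m)" "\<And>m \<omega>. 0 \<le> h m \<omega>" 
      "\<And>n \<omega>. (\<Sum>m<n. h m \<omega>) \<le> \<alpha> / (\<alpha> - 1) * \<bar>f (Z0 \<omega>)\<bar>" for h :: "nat \<Rightarrow> 'w \<Rightarrow> real"
  proof (rule summableI_nonneg_bounded)
    show "0 \<le> expectation (h m)" for m using h(2) by simp
    show "(\<Sum>m<n. expectation (h m)) \<le> expectation (\<lambda>\<omega>. \<alpha> / (\<alpha> - 1) * \<bar>f (Z0 \<omega>)\<bar>)" for n
    proof -
      have "(\<Sum>m<n. expectation (h m)) = expectation (\<lambda>\<omega>. \<Sum>m<n. h m \<omega>)"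
        using h(1) by simp
      also have "\<dots> \<le> expectation (\<lambda>\<omega>. \<alpha> / (\<alpha> - 1) * \<bar>f (Z0 \<omega>)\<bar>)"
        using h int by (intro integral_mono) auto
      finally show ?thesis .
    qed
  qed
  have tail_sum: "summable (\<lambda>m. expectation (tail m))"
    using tail_int tail_nn sum_geometric_below[OF \<alpha>] by (intro sum_bounded) (auto simp: tail_def)
  have head_sum: "summable (\<lambda>m. expectation (head m))"
    using head_int head_nn sum_geometric_above[OF \<alpha>] by (intro sum_bounded) (auto simp: head_def)
  have dev: "AE \<omega> in M. eventually (\<lambda>m. \<bar>avg f (k m) \<omega> - expectation (\<lambda>\<omega>. g m (Z0 \<omega>))\<bar> < 1 / real (Suc j)) sequentially" for j
  proof -
    define \<epsilon> where "\<epsilon> = 1 / real (Suc j)"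
    have \<epsilon>: "\<epsilon> > 0" by (simp add: \<epsilon>_def)
    define B where "B m = {\<omega>\<in>space M. \<epsilon> \<le> \<bar>avg f (k m) \<omega> - expectation (\<lambda>\<omega>. g m (Z0 \<omega>))\<bar>}" for m
    have B_sets: "B m \<in> sets M" for m unfolding B_def by measurable
    have B_prob: "prob (B m) \<le> expectation (tail m) + 2 / \<epsilon>\<^sup>2 * expectation (head m)" for m
    proof -
      define C where "C = {\<omega>\<in>space M. \<epsilon> \<le> \<bar>avg (g m) (k m) \<omega> - expectation (\<lambda>\<omega>. g m (Z0 \<omega>))\<bar>}"
      define D where "D i = {\<omega>\<in>space M. \<alpha> ^ m < \<bar>f (Z i \<omega>)\<bar>}" for i
      have [measurable]: "C \<in> sets M" "D i \<in> sets M" for i unfolding C_def D_def by measurable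
      have "B m \<subseteq> C \<union> (\<Union>i<k m. D i)"
      proof
        fix \<omega> assume \<omega>: "\<omega> \<in> B m"
        show "\<omega> \<in> C \<union> (\<Union>i<k m. D i)"
        proof (cases "\<exists>i<k m. \<alpha> ^ m < \<bar>f (Z i \<omega>)\<bar>")
          case True then show ?thesis using \<omega> by (auto simp: B_def D_def)
        next
          case False
          then have "avg f (k m) \<omega> = avg (g m) (k m) \<omega>" 
            unfolding avg_def by (auto simp: g_def intro!: arg_cong[where f="\<lambda>x. x / _"] sum.cong)
          then show ?thesis using \<omega> by (simp add: B_def C_def)
        qed
      qed
      then have "prob (B m) \<le> prob (C \<union> (\<Union>i<k m. D i))" by (intro finite_measure_mono) auto
      also have "\<dots> \<le> prob C + prob (\<Union>i<k m. D i)" by (intro measure_Un_le) auto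
      also have "prob (\<Union>i<k m. D i) \<le> (\<Sum>i<k m. prob (D i))"
        by (intro finite_measure_subadditive_finite) auto
      also have "\<dots> = real (k m) * prob {\<omega>\<in>space M. \<alpha> ^ m < \<bar>f (Z0 \<omega>)\<bar>}"
        unfolding D_def using prob_copy[of "\<lambda>z. \<alpha> ^ m < \<bar>f z\<bar>"] by simp
      also have "\<dots> \<le> \<alpha> ^ m * prob {\<omega>\<in>space M. \<alpha> ^ m < \<bar>f (Z0 \<omega>)\<bar>}"
        using k by (intro mult_right_mono) auto
      also have "\<dots> = expectation (\<lambda>\<omega>. \<alpha> ^ m * indicator {\<omega>\<in>space M. \<alpha> ^ m < \<bar>f (Z0 \<omega>)\<bar>} \<omega>)"
        by simp
      also have "\<dots> = expectation (tail m)"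
        by (intro Bochner_Integration.integral_cong) (auto simp: tail_def indicator_def)
      also have "prob C \<le> expectation (\<lambda>\<omega>. (g m (Z0 \<omega>))\<^sup>2) / (real (k m) * \<epsilon>\<^sup>2)"
        unfolding C_def using k[of m] \<epsilon> g_sq_int by (intro avg_chebyshev) auto
      also have "\<dots> \<le> expectation (\<lambda>\<omega>. (g m (Z0 \<omega>))\<^sup>2) / (\<alpha> ^ m / 2 * \<epsilon>\<^sup>2)"
        using k[of m] \<epsilon> pos[of m] by (intro divide_left_mono mult_right_mono) auto
      also have "\<dots> = 2 / \<epsilon>\<^sup>2 * expectation (head m)"
        unfolding head_eq[abs_def] by (simp add: mult.commute)
      finally show ?thesis by simp
    qed
    have "summable (\<lambda>m. prob (B m))"
      by (rule summable_comparison_test'[of "\<lambda>m. expectation (tail m) + 2 / \<epsilon>\<^sup>2 * expectation (head m)" 0])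
        (use B_prob tail_sum head_sum in \<open>auto intro!: summable_add summable_mult\<close>)
    then have "AE \<omega> in M. eventually (\<lambda>m. \<omega> \<in> space M - B m) sequentially"
      using B_sets by (intro borel_cantelli_AE1) (auto simp: emeasure_eq_measure)
    then show ?thesis
      by eventually_elim (auto simp: B_def \<epsilon>_def elim!: eventually_mono)
  qed
  have "AE \<omega> in M. \<forall>j. eventually (\<lambda>m. \<bar>avg f (k m) \<omega> - expectation (\<lambda>\<omega>. g m (Z0 \<omega>))\<bar> < 1 / real (Suc j)) sequentially"
    using dev by (simp add: AE_all_countable)
  then show ?thesis
  proof eventually_elim
    case (elim \<omega>)
    have "(\<lambda>m. avg f (k m) \<omega> - expectation (\<lambda>\<omega>. g m (Z0 \<omega>))) \<longlonglongrightarrow> 0"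
    proof (rule tendstoI)
      fix e :: real assume "e > 0"
      then obtain j where "1 / real (Suc j) < e" using nat_approx_posE by blast
      then show "eventually (\<lambda>m. dist (avg f (k m) \<omega> - expectation (\<lambda>\<omega>. g m (Z0 \<omega>))) 0 < e) sequentially"
        using elim[rule_format, of j] by (auto elim!: eventually_mono simp: dist_real_def)
    qed
    from tendsto_add[OF this t_lim] show ?case by (simp add: k_def)
  qed
qed

lemma avg_tendsto_nonneg:
  fixes f :: "'z \<Rightarrow> real"
  assumes [measurable]: "f \<in> borel_measurable N"
    and int: "integrable M (\<lambda>\<omega>. f (Z0 \<omega>))" and nonneg: "\<And>z. 0 \<le> f z"
  shows "AE \<omega> in M. (\<lambda>n. avg f n \<omega>) \<longlonglongrightarrow> expectation (\<lambda>\<omega>. f (Z0 \<omega>))"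
proof -
  have "AE \<omega> in M. \<forall>j. (\<lambda>m. avg f (nat \<lfloor>(1 + 1 / real (Suc j)) ^ m\<rfloor>) \<omega>) \<longlonglongrightarrow> expectation (\<lambda>\<omega>. f (Z0 \<omega>))"
    unfolding AE_all_countable using int by (intro allI avg_geometric_subsequence) auto
  then show ?thesis
  proof eventually_elim
    case (elim \<omega>)
    show ?case unfolding avg_def
    proof (rule LIMSEQ_of_geometric_subsequences)
      show "mono (\<lambda>n. \<Sum>i<n. f (Z i \<omega>))"
        using nonneg by (intro monoI sum_mono2) auto
    qed (use nonneg elim in \<open>auto intro!: sum_nonneg simp: avg_def\<close>)
  qed
qed

theorem avg_tendsto:
  fixes f :: "'z \<Rightarrow> real"
  assumes [measurable]: "f \<in> borel_measurable N" and int: "integrable M (\<lambda>\<omega>. f (Z0 \<omega>))"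
  shows "AE \<omega> in M. (\<lambda>n. avg f n \<omega>) \<longlonglongrightarrow> expectation (\<lambda>\<omega>. f (Z0 \<omega>))"
proof -
  let ?p = "\<lambda>z. max 0 (f z)" and ?q = "\<lambda>z. max 0 (- f z)"
  have i: "integrable M (\<lambda>\<omega>. ?p (Z0 \<omega>))" "integrable M (\<lambda>\<omega>. ?q (Z0 \<omega>))"
    using int by auto
  have split: "f z = ?p z - ?q z" for z by (simp add: max_def)
  have E: "expectation (\<lambda>\<omega>. f (Z0 \<omega>)) = expectation (\<lambda>\<omega>. ?p (Z0 \<omega>)) - expectation (\<lambda>\<omega>. ?q (Z0 \<omega>))"
    using i by (subst split) simp
  have a: "avg f n \<omega> = avg ?p n \<omega> - avg ?q n \<omega>" for n \<omega>
    by (subst split[abs_def]) (rule avg_diff)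
  have "AE \<omega> in M. (\<lambda>n. avg ?p n \<omega>) \<longlonglongrightarrow> expectation (\<lambda>\<omega>. ?p (Z0 \<omega>))"
    "AE \<omega> in M. (\<lambda>n. avg ?q n \<omega>) \<longlonglongrightarrow> expectation (\<lambda>\<omega>. ?q (Z0 \<omega>))"
    using i by (auto intro!: avg_tendsto_nonneg)
  then show ?thesis
    unfolding a E by eventually_elim (rule tendsto_diff)
qed

end

section \<open>Negligible sequences and asymptotic linearity\<close>

context prob_space
begin

lemma prob_tendsto_0_of_AE_eventually_not:
  assumes [measurable]: "\<And>n. E n \<in> sets M"
    and ev: "AE \<omega> in M. eventually (\<lambda>n. \<omega> \<notin> E n) sequentially"
  shows "(\<lambda>n. prob (E n)) \<longlonglongrightarrow> 0"
proof -
  have "(\<lambda>n. expectation (indicator (E n))) \<longlonglongrightarrow> (expectation (\<lambda>\<omega>. 0) :: real)"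
  proof (rule integral_dominated_convergence[where w = "\<lambda>_. 1"])
    show "AE \<omega> in M. (\<lambda>n. indicator (E n) \<omega>) \<longlonglongrightarrow> (0::real)"
      using ev
    proof eventually_elim
      case (elim \<omega>)
      then have "eventually (\<lambda>n. 0 = (indicator (E n) \<omega> :: real)) sequentially"
        by eventually_elim simp
      then show ?case by (rule Lim_transform_eventually[OF tendsto_const])
    qed
  qed (auto simp: indicator_def)
  then show ?thesis by (simp add: sets.Int_space_eq2)
qed

lemma prob_large_tendsto_0:
  fixes Y :: "nat \<Rightarrow> 'a \<Rightarrow> real"
  assumes [measurable]: "\<And>n. Y n \<in> borel_measurable M"
    and lim: "AE \<omega> in M. (\<lambda>n. Y n \<omega>) \<longlonglongrightarrow> 0" and "\<epsilon> > 0"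
  shows "(\<lambda>n. prob {\<omega>\<in>space M. \<epsilon> \<le> \<bar>Y n \<omega>\<bar>}) \<longlonglongrightarrow> 0"
proof (rule prob_tendsto_0_of_AE_eventually_not)
  show "AE \<omega> in M. eventually (\<lambda>n. \<omega> \<notin> {\<omega>\<in>space M. \<epsilon> \<le> \<bar>Y n \<omega>\<bar>}) sequentially"
    using lim
  proof eventually_elim
    case (elim \<omega>)
    from tendstoD[OF this \<open>\<epsilon> > 0\<close>] show ?case by (auto elim!: eventually_mono simp: dist_real_def)
  qed
qed measurable

text \<open>
  Negligibility is insensitive to what happens on measurable events \<open>E n\<close> that almost surely occur only
  finitely often. This is how vanishing denominators and matrices that fail to be positive definite are
  disposed of.
\<close>

lemma small_in_prob_eventually_eq:
  assumes Y: "small_in_prob M Y"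
    and E: "\<And>n. E n \<in> sets M" "AE \<omega> in M. eventually (\<lambda>n. \<omega> \<notin> E n) sequentially"
    and eq: "\<And>n \<omega>. \<omega> \<in> space M \<Longrightarrow> \<omega> \<notin> E n \<Longrightarrow> Y' n \<omega> = Y n \<omega>"
  shows "small_in_prob M Y'"
  unfolding small_in_prob_def
proof (intro allI impI)
  fix \<epsilon> :: real assume "\<epsilon> > 0"
  then obtain A where A: "\<And>n. A n \<in> sets M" "\<And>n. {\<omega>\<in>space M. norm (Y n \<omega>) > \<epsilon>} \<subseteq> A n"
    "(\<lambda>n. prob (A n)) \<longlonglongrightarrow> 0" using Y unfolding small_in_prob_def by metis
  have "(\<lambda>n. prob (A n) + prob (E n)) \<longlonglongrightarrow> 0"
    using tendsto_add[OF A(3) prob_tendsto_0_of_AE_eventually_not[OF E]] by simp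
  then have "(\<lambda>n. prob (A n \<union> E n)) \<longlonglongrightarrow> 0"
    by (rule Lim_null_comparison[rotated])
      (use A(1) E(1) in \<open>auto intro!: always_eventually measure_Un_le\<close>)
  moreover have "{\<omega>\<in>space M. norm (Y' n \<omega>) > \<epsilon>} \<subseteq> A n \<union> E n" for n
    using A(2)[of n] eq[of _ n] by force
  ultimately show "\<exists>A. (\<forall>n. A n \<in> sets M \<and> {\<omega>\<in>space M. norm (Y' n \<omega>) > \<epsilon>} \<subseteq> A n) \<and> (\<lambda>n. prob (A n)) \<longlonglongrightarrow> 0"
    using A(1) E(1) by (intro exI[of _ "\<lambda>n. A n \<union> E n"]) auto
qed

lemma small_in_prob_cong:
  assumes "small_in_prob M Y" "\<And>n \<omega>. \<omega> \<in> space M \<Longrightarrow> Y' n \<omega> = Y n \<omega>"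
  shows "small_in_prob M Y'"
  by (rule small_in_prob_eventually_eq[OF assms(1), of "\<lambda>_. {}"]) (use assms(2) in auto)

text \<open>
  One of the finitely many bounds must exceed the proportional share \<open>\<epsilon> / CARD('i)\<close> whenever their sum
  exceeds \<open>\<epsilon>\<close>. Sums of two sequences and vectors are the cases of interest.
\<close>

lemma small_in_prob_of_finite_bound:
  fixes Y :: "nat \<Rightarrow> 'a \<Rightarrow> 'b::real_normed_vector" and V :: "'i::finite \<Rightarrow> nat \<Rightarrow> 'a \<Rightarrow> 'c::real_normed_vector"
  assumes V: "\<And>i. small_in_prob M (V i)"
    and le: "\<And>n \<omega>. \<omega> \<in> space M \<Longrightarrow> norm (Y n \<omega>) \<le> (\<Sum>i\<in>UNIV. norm (V i n \<omega>))"
  shows "small_in_prob M Y"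
  unfolding small_in_prob_def
proof (intro allI impI)
  fix \<epsilon> :: real assume "\<epsilon> > 0"
  define \<delta> where "\<delta> = \<epsilon> / real CARD('i)"
  have "\<delta> > 0" using \<open>\<epsilon> > 0\<close> by (simp add: \<delta>_def)
  then have "\<forall>i. \<exists>A. (\<forall>n. A n \<in> sets M \<and> {\<omega>\<in>space M. norm (V i n \<omega>) > \<delta>} \<subseteq> A n) \<and> (\<lambda>n. prob (A n)) \<longlonglongrightarrow> 0"
    using V unfolding small_in_prob_def by blast
  then obtain A where A: "\<And>i n. A i n \<in> sets M" "\<And>i n. {\<omega>\<in>space M. norm (V i n \<omega>) > \<delta>} \<subseteq> A i n"
    "\<And>i. (\<lambda>n. prob (A i n)) \<longlonglongrightarrow> 0" by metis
  have "(\<lambda>n. \<Sum>i\<in>UNIV. prob (A i n)) \<longlonglongrightarrow> 0"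
    using tendsto_sum[of UNIV "\<lambda>i n. prob (A i n)" "\<lambda>_. 0" sequentially] A(3) by simp
  then have "(\<lambda>n. prob (\<Union>i. A i n)) \<longlonglongrightarrow> 0"
    by (rule Lim_null_comparison[rotated])
      (use A(1) in \<open>auto intro!: always_eventually finite_measure_subadditive_finite\<close>)
  moreover have "{\<omega>\<in>space M. norm (Y n \<omega>) > \<epsilon>} \<subseteq> (\<Union>i. A i n)" for n
  proof
    fix \<omega> assume \<omega>: "\<omega> \<in> {\<omega>\<in>space M. norm (Y n \<omega>) > \<epsilon>}"
    have "\<exists>i. norm (V i n \<omega>) > \<delta>"
    proof (rule ccontr)
      assume "\<not> ?thesis"
      then have "(\<Sum>i\<in>UNIV. norm (V i n \<omega>)) \<le> (\<Sum>i\<in>(UNIV::'i set). \<delta>)"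
        by (intro sum_mono) (auto simp: not_less)
      then show False using le[of \<omega> n] \<omega> by (simp add: \<delta>_def)
    qed
    then show "\<omega> \<in> (\<Union>i. A i n)" using A(2) \<omega> by blast
  qed
  ultimately show "\<exists>A. (\<forall>n. A n \<in> sets M \<and> {\<omega>\<in>space M. norm (Y n \<omega>) > \<epsilon>} \<subseteq> A n) \<and> (\<lambda>n. prob (A n)) \<longlonglongrightarrow> 0"
    using A(1) by (intro exI[of _ "\<lambda>n. \<Union>i. A i n"]) auto
qed

lemma small_in_prob_add:
  fixes Y Y' :: "nat \<Rightarrow> 'a \<Rightarrow> 'b::real_normed_vector"
  assumes "small_in_prob M Y" "small_in_prob M Y'"
  shows "small_in_prob M (\<lambda>n \<omega>. Y n \<omega> + Y' n \<omega>)"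
proof (rule small_in_prob_of_finite_bound[of "\<lambda>b. if b then Y else Y'"])
  show "small_in_prob M (if b then Y else Y')" for b using assms by simp
  show "norm (Y n \<omega> + Y' n \<omega>) \<le> (\<Sum>b\<in>UNIV. norm ((if b then Y else Y') n \<omega>))" for n \<omega>
    using norm_triangle_ineq[of "Y n \<omega>" "Y' n \<omega>"] by (simp add: UNIV_bool)
qed

lemma small_in_prob_vec:
  fixes Y :: "nat \<Rightarrow> 'a \<Rightarrow> 'b::real_normed_vector ^ 'n::finite"
  assumes "\<And>j. small_in_prob M (\<lambda>n \<omega>. Y n \<omega> $ j)"
  shows "small_in_prob M Y"
  by (rule small_in_prob_of_finite_bound[where V = "\<lambda>j n \<omega>. Y n \<omega> $ j", OF assms]) (simp add: norm_vec_def L2_set_le_sum)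

end

context iid_copies
begin

text \<open>
  By Chebyshev's inequality \<open>\<surd>n avg h n\<close> exceeds a large \<open>K\<close> with a probability of at most \<open>V / K\<^sup>2\<close>,
  whatever \<open>n\<close> is; and where it does not, the product is small as soon as \<open>B n\<close> is.
\<close>

lemma small_in_prob_sqrt_avg_mult:
  fixes h :: "'z \<Rightarrow> real"
  assumes [measurable]: "h \<in> borel_measurable N" "\<And>n. B n \<in> borel_measurable M"
    and sq: "integrable M (\<lambda>\<omega>. (h (Z0 \<omega>))\<^sup>2)" and zero: "expectation (\<lambda>\<omega>. h (Z0 \<omega>)) = 0"
    and B: "AE \<omega> in M. (\<lambda>n. B n \<omega>) \<longlonglongrightarrow> 0"
  shows "small_in_prob M (\<lambda>n \<omega>. sqrt (real n) * avg h n \<omega> * B n \<omega>)"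
  unfolding small_in_prob_def
proof (intro allI impI)
  fix \<epsilon> :: real assume \<epsilon>: "\<epsilon> > 0"
  define A where "A n = {\<omega>\<in>space M. \<epsilon> < \<bar>sqrt (real n) * avg h n \<omega> * B n \<omega>\<bar>}" for n
  have [measurable]: "A n \<in> sets M" for n unfolding A_def by measurable
  define V where "V = expectation (\<lambda>\<omega>. (h (Z0 \<omega>))\<^sup>2)"
  have V: "V \<ge> 0" by (simp add: V_def)
  have "(\<lambda>n. prob (A n)) \<longlonglongrightarrow> 0"
  proof (rule order_tendstoI)
    fix \<delta> :: real assume "0 < \<delta>"
    \<comment> \<open>Chosen such that \<open>V / K\<^sup>2 < \<delta> / 2\<close>; the summand 1 keeps \<open>K\<close> positive when \<open>V = 0\<close>.\<close>
    define K where "K = sqrt (2 * (V + 1) / \<delta>)"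
    have K: "K > 0" "V / K\<^sup>2 < \<delta> / 2" using V \<open>0 < \<delta>\<close> by (auto simp: K_def field_simps)
    have "(\<lambda>n. prob {\<omega>\<in>space M. \<epsilon> / K \<le> \<bar>B n \<omega>\<bar>}) \<longlonglongrightarrow> 0"
      using \<epsilon> K B by (intro prob_large_tendsto_0) auto
    then have "eventually (\<lambda>n. prob {\<omega>\<in>space M. \<epsilon> / K \<le> \<bar>B n \<omega>\<bar>} < \<delta> / 2) sequentially"
      using \<open>0 < \<delta>\<close> by (intro order_tendstoD) auto
    then show "eventually (\<lambda>n. prob (A n) < \<delta>) sequentially"
      using eventually_gt_at_top[of 0]
    proof eventually_elim
      case (elim n)
      have "A n \<subseteq> {\<omega>\<in>space M. K / sqrt (real n) \<le> \<bar>avg h n \<omega>\<bar>} \<union> {\<omega>\<in>space M. \<epsilon> / K \<le> \<bar>B n \<omega>\<bar>}"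
      proof (rule subsetI, rule ccontr)
        fix \<omega> assume 1: "\<omega> \<in> A n" 
          and "\<omega> \<notin> {\<omega>\<in>space M. K / sqrt (real n) \<le> \<bar>avg h n \<omega>\<bar>} \<union> {\<omega>\<in>space M. \<epsilon> / K \<le> \<bar>B n \<omega>\<bar>}"
        then have "sqrt (real n) * \<bar>avg h n \<omega>\<bar> \<le> K" "\<bar>B n \<omega>\<bar> \<le> \<epsilon> / K"
          using elim(2) by (auto simp: A_def field_simps)
        then have "sqrt (real n) * \<bar>avg h n \<omega>\<bar> * \<bar>B n \<omega>\<bar> \<le> K * (\<epsilon> / K)"
          using K by (intro mult_mono) auto
        then show False using 1 K by (simp add: A_def abs_mult)
      qed
      then have "prob (A n) \<le> prob ({\<omega>\<in>space M. K / sqrt (real n) \<le> \<bar>avg h n \<omega>\<bar>} \<union> {\<omega>\<in>space M. \<epsilon> / K \<le> \<bar>B n \<omega>\<bar>})"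
        by (intro finite_measure_mono) auto
      also have "\<dots> \<le> prob {\<omega>\<in>space M. K / sqrt (real n) \<le> \<bar>avg h n \<omega>\<bar>} + prob {\<omega>\<in>space M. \<epsilon> / K \<le> \<bar>B n \<omega>\<bar>}"
        by (intro measure_Un_le) auto
      also have "prob {\<omega>\<in>space M. K / sqrt (real n) \<le> \<bar>avg h n \<omega>\<bar>} \<le> V / (real n * (K / sqrt (real n))\<^sup>2)"
        unfolding V_def using sq zero elim(2) K by (intro avg_chebyshev_centered) auto
      also have "\<dots> = V / K\<^sup>2" using elim(2) by (simp add: power_divide)
      finally show ?case using K(2) elim(1) by linarith
    qed
  qed (use measure_nonneg in \<open>auto intro!: always_eventually elim: less_le_trans\<close>)
  then show "\<exists>A. (\<forall>n. A n \<in> sets M \<and> {\<omega>\<in>space M. norm (sqrt (real n) * avg h n \<omega> * B n \<omega>) > \<epsilon>} \<subseteq> A n) \<and>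
       (\<lambda>n. prob (A n)) \<longlonglongrightarrow> 0"
    by (intro exI[of _ A] conjI allI) (simp_all, auto simp: A_def)
qed

definition asymp_linear ::
    "(nat \<Rightarrow> 'w \<Rightarrow> 'b::real_normed_vector) \<Rightarrow> 'b \<Rightarrow> ('z \<Rightarrow> 'b) \<Rightarrow> bool" where
  "asymp_linear T \<theta> l \<longleftrightarrow> small_in_prob M (\<lambda>n \<omega>.
     sqrt (real n) *\<^sub>R (T n \<omega> - \<theta>) - (1 / sqrt (real n)) *\<^sub>R (\<Sum>i<n. l (Z i \<omega>)))"

lemma scaled_sum_eq_sqrt_avg: "(1 / sqrt (real n)) * (\<Sum>i<n. l (Z i \<omega>)) = sqrt (real n) * avg l n \<omega>"
proof -
  have "1 / sqrt (real n) = sqrt (real n) / real n"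
    by (simp add: sqrt_divide_self_eq inverse_eq_divide)
  then show ?thesis by (simp add: avg_def)
qed

lemma asymp_linear_real:
  "asymp_linear T \<theta> l \<longleftrightarrow> small_in_prob M (\<lambda>n \<omega>. sqrt (real n) * (T n \<omega> - \<theta> - avg l n \<omega>))"
  for T :: "nat \<Rightarrow> 'w \<Rightarrow> real"
  unfolding asymp_linear_def real_scaleR_def scaled_sum_eq_sqrt_avg right_diff_distrib by (rule refl)

lemma asymp_linear_vec:
  fixes T :: "nat \<Rightarrow> 'w \<Rightarrow> 'b::real_normed_vector ^ 'n::finite"
  assumes "\<And>j. asymp_linear (\<lambda>n \<omega>. T n \<omega> $ j) (\<theta> $ j) (\<lambda>z. l z $ j)"
  shows "asymp_linear T \<theta> l"
  unfolding asymp_linear_def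
  by (rule small_in_prob_vec)
    (use assms in \<open>simp only: asymp_linear_def vector_minus_component vector_scaleR_component sum_component\<close>)

lemma asymp_linear_perturb:
  assumes "asymp_linear T \<theta> l" "small_in_prob M (\<lambda>n \<omega>. sqrt (real n) *\<^sub>R (T' n \<omega> - T n \<omega>))"
  shows "asymp_linear T' \<theta> l"
  using small_in_prob_add[OF assms[unfolded asymp_linear_def]] unfolding asymp_linear_def
  by (rule small_in_prob_cong) (simp add: scaleR_diff_right)

lemma asymp_linear_eventually_eq:
  assumes T: "asymp_linear T \<theta> l"
    and E: "\<And>n. E n \<in> sets M" "AE \<omega> in M. eventually (\<lambda>n. \<omega> \<notin> E n) sequentially"
    and eq: "\<And>n \<omega>. \<omega> \<in> space M \<Longrightarrow> \<omega> \<notin> E n \<Longrightarrow> T' n \<omega> = T n \<omega>"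
  shows "asymp_linear T' \<theta> l"
  using T unfolding asymp_linear_def
  by (rule small_in_prob_eventually_eq[OF _ E]) (use eq in auto)

text \<open>
  For ratios of empirical means the expectation of the numerator is written as \<open>\<theta>\<close> times that of the
  denominator, so that \<open>\<theta>\<close> is the quantity estimated.
\<close>

lemma ratio_tendsto:
  fixes f g :: "'z \<Rightarrow> real"
  assumes [measurable]: "f \<in> borel_measurable N" "g \<in> borel_measurable N"
    and f: "integrable M (\<lambda>\<omega>. f (Z0 \<omega>))" and g: "integrable M (\<lambda>\<omega>. g (Z0 \<omega>))"
    and m: "expectation (\<lambda>\<omega>. g (Z0 \<omega>)) \<noteq> 0"
    and \<theta>: "expectation (\<lambda>\<omega>. f (Z0 \<omega>)) = \<theta> * expectation (\<lambda>\<omega>. g (Z0 \<omega>))"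
  shows "AE \<omega> in M. (\<lambda>n. avg f n \<omega> / avg g n \<omega>) \<longlonglongrightarrow> \<theta>"
  using avg_tendsto[OF assms(1) f] avg_tendsto[OF assms(2) g]
proof eventually_elim
  case (elim \<omega>)
  from tendsto_divide[OF elim m] m \<theta> show ?case by simp
qed

lemma avg_eventually_nonzero:
  assumes [measurable]: "g \<in> borel_measurable N" 
    and g: "integrable M (\<lambda>\<omega>. g (Z0 \<omega>))" and m: "expectation (\<lambda>\<omega>. g (Z0 \<omega>)) \<noteq> 0"
  shows "AE \<omega> in M. eventually (\<lambda>n. avg g n \<omega> \<noteq> 0) sequentially"
  using avg_tendsto[OF assms(1) g] by eventually_elim (rule tendsto_imp_eventually_ne[OF _ m])

text \<open>
  With \<open>H = F - \<theta> G\<close> for the averages \<open>F\<close>, \<open>G\<close> of \<open>f\<close>, \<open>g\<close>, the error of the linearization is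
  \<open>H / G - H / m = (G - m) (- H / (m G))\<close>. Only \<open>G - m\<close> has to be of order \<open>n\<^sup>-\<^sup>1\<^sup>/\<^sup>2\<close>, since the second
  factor tends to 0 by the law of large numbers; hence a first moment of \<open>f\<close> suffices.
\<close>

lemma asymp_linear_ratio:
  fixes f g :: "'z \<Rightarrow> real"
  assumes [measurable]: "f \<in> borel_measurable N" "g \<in> borel_measurable N"
    and f: "integrable M (\<lambda>\<omega>. f (Z0 \<omega>))" and g_sq: "integrable M (\<lambda>\<omega>. (g (Z0 \<omega>))\<^sup>2)"
    and m_def: "m = expectation (\<lambda>\<omega>. g (Z0 \<omega>))" and m: "m \<noteq> 0"
    and \<theta>: "expectation (\<lambda>\<omega>. f (Z0 \<omega>)) = \<theta> * m"
  shows "asymp_linear (\<lambda>n \<omega>. avg f n \<omega> / avg g n \<omega>) \<theta> (\<lambda>z. (f z - \<theta> * g z) / m)"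
proof -
  have g: "integrable M (\<lambda>\<omega>. g (Z0 \<omega>))"
    using g_sq by (rule square_integrable_imp_integrable[rotated]) simp
  let ?H = "\<lambda>n \<omega>. avg f n \<omega> - \<theta> * avg g n \<omega>"
  have "small_in_prob M (\<lambda>n \<omega>. sqrt (real n) * avg (\<lambda>z. g z - m) n \<omega> * (- ?H n \<omega> / (m * avg g n \<omega>)))"
  proof (rule small_in_prob_sqrt_avg_mult)
    have "(\<lambda>z. (g z - m)\<^sup>2) = (\<lambda>z. (g z)\<^sup>2 - 2 * m * g z + m\<^sup>2)"
      by (simp add: power2_eq_square algebra_simps fun_eq_iff)
    then show "integrable M (\<lambda>\<omega>. (g (Z0 \<omega>) - m)\<^sup>2)" using g g_sq by (simp add: fun_eq_iff)
    show "expectation (\<lambda>\<omega>. g (Z0 \<omega>) - m) = 0" using g by (simp add: m_def prob_space)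
    show "AE \<omega> in M. (\<lambda>n. - ?H n \<omega> / (m * avg g n \<omega>)) \<longlonglongrightarrow> 0"
      using avg_tendsto[OF assms(1) f] avg_tendsto[OF assms(2) g]
    proof eventually_elim
      case (elim \<omega>)
      have "(\<lambda>n. - ?H n \<omega> / (m * avg g n \<omega>)) \<longlonglongrightarrow> - (\<theta> * m - \<theta> * m) / (m * m)"
        using elim m unfolding \<theta> m_def[symmetric] by (intro tendsto_intros) auto
      then show ?case by simp
    qed
  qed measurable
  then show ?thesis unfolding asymp_linear_real
  proof (rule small_in_prob_eventually_eq[where E = "\<lambda>n. {\<omega>\<in>space M. avg g n \<omega> = 0}"])
    show "AE \<omega> in M. eventually (\<lambda>n. \<omega> \<notin> {\<omega>\<in>space M. avg g n \<omega> = 0}) sequentially"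
      using avg_eventually_nonzero[OF _ g] m by (simp add: m_def)
    fix n \<omega> assume "\<omega> \<in> space M" "\<omega> \<notin> {\<omega>\<in>space M. avg g n \<omega> = 0}"
    then have G: "avg g n \<omega> \<noteq> 0" by simp
    then have n: "n > 0" by (cases n) (auto simp: avg_def)
    have "avg (\<lambda>z. (f z - \<theta> * g z) / m) n \<omega> = ?H n \<omega> / m"
      using avg_cmult[of "1 / m" "\<lambda>z. f z - \<theta> * g z"] by (simp add: avg_diff avg_cmult)
    then have eq: "avg (\<lambda>z. (f z - \<theta> * g z) / m) n \<omega> = ?H n \<omega> / m" .
    have "avg f n \<omega> / avg g n \<omega> - \<theta> - avg (\<lambda>z. (f z - \<theta> * g z) / m) n \<omega>
       = avg (\<lambda>z. g z - m) n \<omega> * (- ?H n \<omega> / (m * avg g n \<omega>))"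
      unfolding eq using G m n by (simp add: avg_diff avg_const divide_simps) (simp add: algebra_simps)
    then show "sqrt (real n) * (avg f n \<omega> / avg g n \<omega> - \<theta> - avg (\<lambda>z. (f z - \<theta> * g z) / m) n \<omega>)
       = sqrt (real n) * avg (\<lambda>z. g z - m) n \<omega> * (- ?H n \<omega> / (m * avg g n \<omega>))" by simp
  qed measurable
qed

text \<open>
  The delta method: the difference quotient of \<open>\<phi>\<close> at \<open>q\<close>, minus \<open>D\<close>, is a function of the empirical mean
  that is continuous at \<open>q\<close> with value 0.
\<close>

lemma asymp_linear_smooth_transform:
  fixes g :: "'z \<Rightarrow> real" and \<phi> :: "real \<Rightarrow> real"
  assumes [measurable]: "g \<in> borel_measurable N" "\<phi> \<in> borel_measurable borel"
    and g_sq: "integrable M (\<lambda>\<omega>. (g (Z0 \<omega>))\<^sup>2)"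
    and q: "q = expectation (\<lambda>\<omega>. g (Z0 \<omega>))"
    and D: "(\<phi> has_real_derivative D) (at q)"
  shows "asymp_linear (\<lambda>n \<omega>. \<phi> (avg g n \<omega>)) (\<phi> q) (\<lambda>z. D * (g z - q))"
proof -
  have g: "integrable M (\<lambda>\<omega>. g (Z0 \<omega>))"
    using g_sq by (rule square_integrable_imp_integrable[rotated]) simp
  define r where "r z = (if z = q then 0 else (\<phi> z - \<phi> q) / (z - q) - D)" for z
  have [measurable]: "r \<in> borel_measurable borel" unfolding r_def by measurable
  have "((\<lambda>z. (\<phi> z - \<phi> q) / (z - q) - D) \<longlongrightarrow> D - D) (at q)"
    using D by (intro tendsto_diff tendsto_const) (simp add: has_field_derivative_iff)
  moreover have "eventually (\<lambda>z. (\<phi> z - \<phi> q) / (z - q) - D = r z) (at q)"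
    by (simp add: eventually_at_filter r_def)
  ultimately have "(r \<longlongrightarrow> D - D) (at q)" by (rule Lim_transform_eventually)
  then have r: "isCont r q" by (simp add: isCont_def r_def)
  have "small_in_prob M (\<lambda>n \<omega>. sqrt (real n) * avg (\<lambda>z. g z - q) n \<omega> * r (avg g n \<omega>))"
  proof (rule small_in_prob_sqrt_avg_mult)
    have "(\<lambda>z. (g z - q)\<^sup>2) = (\<lambda>z. (g z)\<^sup>2 - 2 * q * g z + q\<^sup>2)"
      by (simp add: power2_eq_square algebra_simps fun_eq_iff)
    then show "integrable M (\<lambda>\<omega>. (g (Z0 \<omega>) - q)\<^sup>2)" using g g_sq by (simp add: fun_eq_iff)
    show "expectation (\<lambda>\<omega>. g (Z0 \<omega>) - q) = 0" using g by (simp add: q prob_space)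
    show "AE \<omega> in M. (\<lambda>n. r (avg g n \<omega>)) \<longlonglongrightarrow> 0"
      using avg_tendsto[OF assms(1) g, folded q]
      by eventually_elim (use isCont_tendsto_compose[OF r] in \<open>simp add: r_def\<close>)
  qed measurable
  then show ?thesis unfolding asymp_linear_real
  proof (rule small_in_prob_cong)
    fix n \<omega>
    show "sqrt (real n) * (\<phi> (avg g n \<omega>) - \<phi> q - avg (\<lambda>z. D * (g z - q)) n \<omega>) =
          sqrt (real n) * avg (\<lambda>z. g z - q) n \<omega> * r (avg g n \<omega>)"
    proof (cases "n = 0")
      case False
      have cancel: "x * (a / x - b) = a - b * x" if "x \<noteq> 0" for x a b :: real
        using that by (simp add: right_diff_distrib)
      have "(avg g n \<omega> - q) * r (avg g n \<omega>) = \<phi> (avg g n \<omega>) - \<phi> q - D * (avg g n \<omega> - q)"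
        using cancel[of "avg g n \<omega> - q" "\<phi> (avg g n \<omega>) - \<phi> q" D] by (simp add: r_def)
      then show ?thesis using False by (simp add: avg_cmult avg_diff avg_const mult.assoc)
    qed simp
  qed
qed

end

section \<open>Square roots of positive definite matrices\<close>

lemma norm_matrix_vector_le:
  fixes A :: "real ^ 'n::finite ^ 'm::finite"
  shows "norm (A *v x) \<le> norm A * norm x"
proof -
  have "norm (A *v x) = L2_set (\<lambda>i. norm (A $ i \<bullet> x)) UNIV"
    by (simp add: norm_vec_def matrix_vector_mul_component)
  also have "\<dots> \<le> L2_set (\<lambda>i. norm (A $ i) * norm x) UNIV"
    by (intro L2_set_mono) (auto simp: Cauchy_Schwarz_ineq2)
  also have "\<dots> = norm A * norm x"
    by (simp add: norm_vec_def[of A] L2_set_left_distrib)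
  finally show ?thesis .
qed

text \<open>
  Positive definiteness of symmetric matrices is an open condition: the quadratic form of \<open>\<Sigma>\<close> is bounded below
  by its minimum on the unit sphere, which is positive by compactness, and a perturbation of smaller norm
  does not change the sign.
\<close>

lemma pos_def_open:
  fixes \<Sigma> :: "real ^ 'd::finite ^ 'd"
  assumes "pos_def \<Sigma>"
  obtains \<delta> where "\<delta> > 0" "\<And>S. transpose S = S \<Longrightarrow> norm (S - \<Sigma>) < \<delta> \<Longrightarrow> pos_def S"
proof -
  define Q where "Q x = x \<bullet> (\<Sigma> *v x)" for x
  have pos: "0 < Q x" if "x \<noteq> 0" for x using assms that by (simp add: pos_def_def Q_def)
  have cont: "continuous_on (sphere 0 1) Q" unfolding Q_def
    by (intro continuous_intros linear_continuous_on matrix_vector_mul_bounded_linear)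
  obtain y where y: "y \<in> sphere (0 :: real ^ 'd) 1" "\<And>x. x \<in> sphere 0 1 \<Longrightarrow> Q y \<le> Q x"
    using continuous_attains_inf[OF compact_sphere _ cont] by (auto simp: sphere_eq_empty)
  have "Q y > 0" using y(1) by (intro pos) auto
  then show thesis
  proof (rule that)
    fix S :: "real ^ 'd ^ 'd" assume sym: "transpose S = S" and near: "norm (S - \<Sigma>) < Q y"
    have "0 < x \<bullet> (S *v x)" if x: "x \<noteq> 0" for x
    proof -
      have "Q y \<le> Q ((1 / norm x) *\<^sub>R x)" using x by (intro y(2)) simp
      also have "\<dots> = Q x / (norm x)\<^sup>2"
        by (simp add: Q_def matrix_vector_mult_scaleR power2_eq_square)
      finally have 1: "Q y * (norm x)\<^sup>2 \<le> Q x" using x by (simp add: field_simps)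
      have "\<bar>x \<bullet> ((S - \<Sigma>) *v x)\<bar> \<le> norm x * norm ((S - \<Sigma>) *v x)" by (rule Cauchy_Schwarz_ineq2)
      also have "\<dots> \<le> norm x * (norm (S - \<Sigma>) * norm x)"
        by (intro mult_left_mono norm_matrix_vector_le) auto
      also have "\<dots> < norm x * (Q y * norm x)"
        using near x by (intro mult_strict_left_mono mult_strict_right_mono) auto
      also have "\<dots> = Q y * (norm x)\<^sup>2" by (simp add: power2_eq_square)
      finally have 2: "\<bar>x \<bullet> ((S - \<Sigma>) *v x)\<bar> < Q y * (norm x)\<^sup>2" .
      have "x \<bullet> (S *v x) = Q x + x \<bullet> ((S - \<Sigma>) *v x)"
        by (simp add: Q_def matrix_vector_mult_diff_rdistrib inner_diff_right)
      then show ?thesis using 1 2 by linarith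
    qed
    then show "pos_def S" using sym by (simp add: pos_def_def)
  qed
qed

lemma trace_conjugate_symmetric:
  fixes D A :: "real ^ 'd::finite ^ 'd"
  assumes "transpose D = D"
  shows "trace (D ** A ** D) = (\<Sum>i\<in>UNIV. D $ i \<bullet> (A *v (D $ i)))"
proof -
  have sym: "D $ i $ j = D $ j $ i" for i j using assms by (metis transpose_def vec_lambda_beta)
  show ?thesis
    unfolding trace_def matrix_mul_assoc[symmetric]
    by (simp add: matrix_matrix_mult_def matrix_vector_mult_def inner_vec_def sym)
qed

text \<open>
  Uniqueness of the square root without diagonalization: for a second root \<open>R\<close> and \<open>D = R - S\<close>, the identity
  \<open>R R = S S\<close> reads \<open>S D + D R = 0\<close>. Multiplying by \<open>D\<close> and taking traces gives
  \<open>tr (D S D) + tr (D R D) = 0\<close>, where both traces are sums of values of nonnegative quadratic forms at the rows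
  of \<open>D\<close>. All these values vanish, and definiteness of \<open>S\<close> forces \<open>D = 0\<close>.
\<close>

lemma psd_sqrt_square:
  fixes S :: "real ^ 'd::finite ^ 'd"
  assumes S: "pos_def S"
  shows "psd_sqrt (S ** S) = S"
  unfolding psd_sqrt_def
proof (rule the_equality)
  have S_nonneg: "0 \<le> x \<bullet> (S *v x)" for x
    using S by (cases "x = 0") (auto simp: pos_def_def less_imp_le)
  then show "pos_semidef S \<and> S ** S = S ** S" using S by (simp add: pos_semidef_def pos_def_def)
  fix R assume R: "pos_semidef R \<and> R ** R = S ** S"
  define D where "D = R - S"
  have sym: "transpose D = D"
    using R S by (simp add: D_def pos_semidef_def pos_def_def transpose_def vec_eq_iff)
  have "S ** D + D ** R = 0"
  proof -
    have "S ** D = S ** R - S ** S" "D ** R = R ** R - S ** R"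
      by (simp_all add: D_def matrix_matrix_mult_def vec_eq_iff sum_subtractf
          right_diff_distrib left_diff_distrib)
    then show ?thesis using R by simp
  qed
  then have "trace (D ** (S ** D + D ** R)) = 0" by (simp add: trace_def matrix_matrix_mult_def)
  moreover have "trace (D ** (D ** R)) = trace (D ** R ** D)"
    using trace_mul_sym[of D "D ** R"] by simp
  ultimately have "trace (D ** S ** D) + trace (D ** R ** D) = 0"
    by (simp add: matrix_add_ldistrib trace_add matrix_mul_assoc)
  then have "(\<Sum>i\<in>UNIV. D $ i \<bullet> (S *v (D $ i))) + (\<Sum>i\<in>UNIV. D $ i \<bullet> (R *v (D $ i))) = 0"
    by (simp add: trace_conjugate_symmetric[OF sym])
  moreover have "0 \<le> (\<Sum>i\<in>UNIV. D $ i \<bullet> (R *v (D $ i)))"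
    using R by (intro sum_nonneg) (auto simp: pos_semidef_def)
  moreover have "0 \<le> (\<Sum>i\<in>UNIV. D $ i \<bullet> (S *v (D $ i)))"
    by (intro sum_nonneg S_nonneg)
  ultimately have "(\<Sum>i\<in>UNIV. D $ i \<bullet> (S *v (D $ i))) = 0" by linarith
  then have "D $ i \<bullet> (S *v (D $ i)) = 0" for i
    using S_nonneg by (subst (asm) sum_nonneg_eq_0_iff) auto
  then have "D $ i = 0" for i using S unfolding pos_def_def by (metis less_irrefl)
  then have "D = 0" by (simp add: vec_eq_iff)
  then show "R = S" by (simp add: D_def)
qed

section \<open>Random vectors and matrices, componentwise\<close>

text \<open>
  Measurability and integrability are checked entry by entry; a matrix is a vector of vectors, so the lemmas
  are stated for entries in any Euclidean space and applied twice.
\<close>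

lemma integrable_vec:
  fixes f :: "'w \<Rightarrow> 'b::euclidean_space ^ 'n::finite"
  assumes "\<And>j. integrable M (\<lambda>\<omega>. f \<omega> $ j)"
  shows "integrable M f"
proof -
  have eq: "f \<omega> = (\<Sum>j\<in>UNIV. axis j (f \<omega> $ j))" for \<omega>
    by (simp add: vec_eq_iff axis_def if_distrib cong: if_cong)
  have "bounded_linear (axis j :: 'b \<Rightarrow> 'b ^ 'n)" for j
    unfolding linear_conv_bounded_linear[symmetric]
    by (rule linearI) (auto simp: vec_eq_iff axis_def)
  then have "integrable M (\<lambda>\<omega>. \<Sum>j\<in>UNIV. axis j (f \<omega> $ j))"
    by (intro Bochner_Integration.integrable_sum integrable_bounded_linear[OF _ assms])
  then show ?thesis by (simp only: eq[symmetric])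
qed

lemma borel_measurable_vec:
  fixes f :: "'w \<Rightarrow> 'b::euclidean_space ^ 'n::finite"
  assumes "\<And>j. (\<lambda>\<omega>. f \<omega> $ j) \<in> borel_measurable M"
  shows "f \<in> borel_measurable M"
proof (subst borel_measurable_euclidean_space, intro ballI)
  fix b :: "'b ^ 'n" assume "b \<in> Basis"
  then obtain i u where b: "b = axis i u" by (auto simp: Basis_vec_def)
  show "(\<lambda>\<omega>. f \<omega> \<bullet> b) \<in> borel_measurable M"
    unfolding b inner_axis using assms by simp
qed

lemma integral_vec_nth:
  fixes f :: "'w \<Rightarrow> 'b::euclidean_space ^ 'n::finite"
  assumes "integrable M f"
  shows "integral\<^sup>L M f $ j = integral\<^sup>L M (\<lambda>\<omega>. f \<omega> $ j)"
  using integral_bounded_linear[OF bounded_linear_vec_nth assms] by simp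

lemma norm_vec_square:
  fixes v :: "'b::real_normed_vector ^ 'n::finite"
  shows "(norm v)\<^sup>2 = (\<Sum>j\<in>UNIV. (norm (v $ j))\<^sup>2)"
  by (simp add: norm_vec_def L2_set_def sum_nonneg)

lemma borel_measurable_vec_nth [measurable (raw)]:
  fixes f :: "'w \<Rightarrow> 'b::euclidean_space ^ 'n::finite"
  assumes "f \<in> borel_measurable M"
  shows "(\<lambda>\<omega>. f \<omega> $ j) \<in> borel_measurable M"
  using assms by (rule borel_measurable_continuous_on[rotated]) (intro continuous_intros)

section \<open>Moments of incompletely observed vectors\<close>

text \<open>
  The distributional assumptions concern the observed pairs, since these are all that the estimators see of
  the sample.
\<close>

locale missing_data = prob_space M for M :: "'w measure" +
  fixes X I :: "'w \<Rightarrow> ('d::finite) rvec" and Xs Is :: "nat \<Rightarrow> 'w \<Rightarrow> 'd rvec"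
  assumes X_meas [measurable]: "X \<in> borel_measurable M"
    and X_sq: "integrable M (\<lambda>\<omega>. (norm (X \<omega>))\<^sup>2)"
    and I_cube: "I \<in> measurable M (count_space cube)"
    and indep_IX: "indep_var (count_space cube) I borel X"
    and prob_I_1: "prob {\<omega>\<in>space M. I \<omega> = 1} > 0"
    and Is_cube: "\<And>i. Is i \<in> measurable M (count_space cube)"
    and sample_indep: "indep_vars (\<lambda>_. borel \<Otimes>\<^sub>M borel) (\<lambda>i \<omega>. (Is i \<omega>, Is i \<omega> * Xs i \<omega>)) UNIV"
    and sample_distr: "\<And>i. distr M (borel \<Otimes>\<^sub>M borel) (\<lambda>\<omega>. (Is i \<omega>, Is i \<omega> * Xs i \<omega>)) =
                            distr M (borel \<Otimes>\<^sub>M borel) (\<lambda>\<omega>. (I \<omega>, I \<omega> * X \<omega>))"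
begin

lemma borel_measurable_of_cube:
  assumes "J \<in> measurable M (count_space cube)"
  shows "J \<in> borel_measurable M"
  using measurable_compose[OF assms, of "\<lambda>a. a" borel] by simp

lemma I_meas [measurable]: "I \<in> borel_measurable M"
  by (rule borel_measurable_of_cube[OF I_cube])

lemma I_mult_X_meas [measurable]: "(\<lambda>\<omega>. I \<omega> * X \<omega>) \<in> borel_measurable M"
  by (rule borel_measurable_vec) simp

sublocale iid_copies M "borel \<Otimes>\<^sub>M borel" "\<lambda>i \<omega>. (Is i \<omega>, Is i \<omega> * Xs i \<omega>)" "\<lambda>\<omega>. (I \<omega>, I \<omega> * X \<omega>)"
  by unfold_locales (use sample_indep sample_distr in simp_all)

lemma I_01: "\<omega> \<in> space M \<Longrightarrow> I \<omega> $ j = 0 \<or> I \<omega> $ j = 1"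
  using measurable_space[OF I_cube] by (auto simp: cube_def)

lemma Is_01: "\<omega> \<in> space M \<Longrightarrow> Is i \<omega> \<in> cube"
  using measurable_space[OF Is_cube] by simp

abbreviation mean :: "'d rvec" where "mean \<equiv> expectation X"
abbreviation cov :: "'d rmat" where "cov \<equiv> cov_mat M X"

definition cent :: "'d \<Rightarrow> 'w \<Rightarrow> real" where "cent j \<omega> = X \<omega> $ j - mean $ j"

lemma cent_meas [measurable]: "cent j \<in> borel_measurable M"
  unfolding cent_def by measurable

lemma X_nth_sq: "integrable M (\<lambda>\<omega>. (X \<omega> $ j)\<^sup>2)"
proof (rule Bochner_Integration.integrable_bound[OF X_sq])
  show "AE \<omega> in M. norm ((X \<omega> $ j)\<^sup>2) \<le> norm ((norm (X \<omega>))\<^sup>2)"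
    using power_mono[OF component_le_norm_cart[of "X _" j], where n = 2] by simp
qed simp

lemma X_nth_int: "integrable M (\<lambda>\<omega>. X \<omega> $ j)"
  using X_nth_sq by (rule square_integrable_imp_integrable[rotated]) simp

lemma mean_nth: "mean $ j = expectation (\<lambda>\<omega>. X \<omega> $ j)"
  by (rule integral_vec_nth[OF integrable_vec[OF X_nth_int]])

lemma cent_int: "integrable M (cent j)" and cent_zero: "expectation (cent j) = 0"
  unfolding cent_def[abs_def] using X_nth_int by (simp_all add: mean_nth prob_space)

lemma cent_sq: "integrable M (\<lambda>\<omega>. (cent j \<omega>)\<^sup>2)"
proof -
  have "(cent j \<omega>)\<^sup>2 = (X \<omega> $ j)\<^sup>2 - 2 * mean $ j * X \<omega> $ j + (mean $ j)\<^sup>2" for \<omega>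
    by (simp add: cent_def power2_eq_square algebra_simps)
  then show ?thesis using X_nth_sq X_nth_int by simp
qed

lemma cent_mult_int: "integrable M (\<lambda>\<omega>. cent j \<omega> * cent k \<omega>)"
proof (rule Bochner_Integration.integrable_bound)
  show "integrable M (\<lambda>\<omega>. (cent j \<omega>)\<^sup>2 + (cent k \<omega>)\<^sup>2)" using cent_sq by simp
  show "AE \<omega> in M. norm (cent j \<omega> * cent k \<omega>) \<le> norm ((cent j \<omega>)\<^sup>2 + (cent k \<omega>)\<^sup>2)"
  proof (rule AE_I2)
    fix \<omega>
    have "2 * (\<bar>cent j \<omega>\<bar> * \<bar>cent k \<omega>\<bar>) \<le> (cent j \<omega>)\<^sup>2 + (cent k \<omega>)\<^sup>2"
      using sum_squares_bound[of "\<bar>cent j \<omega>\<bar>" "\<bar>cent k \<omega>\<bar>"] by simp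
    moreover have "0 \<le> \<bar>cent j \<omega>\<bar> * \<bar>cent k \<omega>\<bar>" by simp
    ultimately show "norm (cent j \<omega> * cent k \<omega>) \<le> norm ((cent j \<omega>)\<^sup>2 + (cent k \<omega>)\<^sup>2)"
      unfolding real_norm_def abs_mult by linarith
  qed
qed simp

lemma cov_nth: "cov $ j $ k = expectation (\<lambda>\<omega>. cent j \<omega> * cent k \<omega>)"
  by (simp add: cov_mat_def cent_def mean_nth)

definition pair_prob :: "'d \<Rightarrow> 'd \<Rightarrow> real" where
  "pair_prob j k = expectation (\<lambda>\<omega>. I \<omega> $ j * I \<omega> $ k)"

lemma I_pair_int: "integrable M (\<lambda>\<omega>. I \<omega> $ j * I \<omega> $ k)"
proof (rule integrable_const_bound[of _ 1])
  show "AE \<omega> in M. norm (I \<omega> $ j * I \<omega> $ k) \<le> 1"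
    using I_01[of _ j] I_01[of _ k] by (intro AE_I2) fastforce
qed simp

text \<open>
  All components are observed together with positive probability, so every pair of them is.
\<close>

lemma pair_prob_pos: "pair_prob j k > 0"
proof -
  have "0 < prob {\<omega>\<in>space M. I \<omega> = 1}" by (rule prob_I_1)
  also have "\<dots> = expectation (indicator {\<omega>\<in>space M. I \<omega> = 1})" by simp
  also have "\<dots> \<le> pair_prob j k" unfolding pair_prob_def
  proof (rule integral_mono)
    show "integrable M (indicator {\<omega>\<in>space M. I \<omega> = 1} :: 'w \<Rightarrow> real)"
      by (rule integrable_real_indicator) (simp_all add: emeasure_eq_measure)
  next
    fix \<omega> assume "\<omega> \<in> space M"
    then show "indicator {\<omega>\<in>space M. I \<omega> = 1} \<omega> \<le> I \<omega> $ j * I \<omega> $ k"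
      using I_01[of \<omega> j] I_01[of \<omega> k] by (auto simp: indicator_def)
  qed (rule I_pair_int)
  finally show ?thesis .
qed

text \<open>
  Independence of \<open>I\<close> and \<open>X\<close> enters through this factorization only. The choice \<open>j = k\<close> covers a
  single indicator, because indicators are idempotent.
\<close>

lemma expectation_I_pair_mult:
  assumes v [measurable]: "v \<in> borel_measurable borel" and int: "integrable M (\<lambda>\<omega>. v (X \<omega>))"
  shows "integrable M (\<lambda>\<omega>. I \<omega> $ j * I \<omega> $ k * v (X \<omega>))"
    and "expectation (\<lambda>\<omega>. I \<omega> $ j * I \<omega> $ k * v (X \<omega>)) = pair_prob j k * expectation (\<lambda>\<omega>. v (X \<omega>))"
proof -
  have ind: "indep_var borel (\<lambda>\<omega>. I \<omega> $ j * I \<omega> $ k) borel (\<lambda>\<omega>. v (X \<omega>))"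
    using indep_var_compose[OF indep_IX, of "\<lambda>a. a $ j * a $ k" borel v borel]
    by (simp add: comp_def)
  show "integrable M (\<lambda>\<omega>. I \<omega> $ j * I \<omega> $ k * v (X \<omega>))"
    by (rule indep_var_integrable[OF ind I_pair_int int])
  show "expectation (\<lambda>\<omega>. I \<omega> $ j * I \<omega> $ k * v (X \<omega>)) = pair_prob j k * expectation (\<lambda>\<omega>. v (X \<omega>))"
    unfolding pair_prob_def by (rule indep_var_lebesgue_integral[OF ind I_pair_int int])
qed

lemma I_sq: "\<omega> \<in> space M \<Longrightarrow> I \<omega> $ j * I \<omega> $ j = I \<omega> $ j"
  using I_01[of \<omega> j] by auto

text \<open>
  On the observed pairs, \<open>seen j\<close> is \<open>I(j)\<close> and \<open>dev j\<close> is \<open>I(j) (X(j) - \<mu>(j))\<close>, the deviation from the mean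
  where the component is observed and 0 elsewhere. The estimators of mean and covariance are functions of the
  empirical means of these functions and of their pairwise products.
\<close>

definition seen :: "'d \<Rightarrow> 'd rvec \<times> 'd rvec \<Rightarrow> real" where "seen j z = fst z $ j"
definition dev :: "'d \<Rightarrow> 'd rvec \<times> 'd rvec \<Rightarrow> real" where "dev j z = snd z $ j - mean $ j * fst z $ j"

lemma seen_meas [measurable]: "seen j \<in> borel_measurable (borel \<Otimes>\<^sub>M borel)"
  unfolding seen_def by measurable

lemma dev_meas [measurable]: "dev j \<in> borel_measurable (borel \<Otimes>\<^sub>M borel)"
  unfolding dev_def by measurable

lemma seen_I: "seen j (I \<omega>, I \<omega> * X \<omega>) = I \<omega> $ j"
  by (simp add: seen_def)

lemma dev_I: "dev j (I \<omega>, I \<omega> * X \<omega>) = I \<omega> $ j * cent j \<omega>"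
  by (simp add: dev_def cent_def algebra_simps)

lemma seen_pair:
  shows "integrable M (\<lambda>\<omega>. seen j (I \<omega>, I \<omega> * X \<omega>) * seen k (I \<omega>, I \<omega> * X \<omega>))"
    and "expectation (\<lambda>\<omega>. seen j (I \<omega>, I \<omega> * X \<omega>) * seen k (I \<omega>, I \<omega> * X \<omega>)) = pair_prob j k"
  using I_pair_int by (simp_all add: seen_I pair_prob_def)

lemma seen_pair_sq: "integrable M (\<lambda>\<omega>. (seen j (I \<omega>, I \<omega> * X \<omega>) * seen k (I \<omega>, I \<omega> * X \<omega>))\<^sup>2)"
  unfolding seen_I
proof (rule integrable_const_bound[of _ 1])
  show "AE \<omega> in M. norm ((I \<omega> $ j * I \<omega> $ k)\<^sup>2) \<le> 1"
    using I_01[of _ j] I_01[of _ k] by (intro AE_I2) fastforce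
qed simp

lemma seen_single:
  shows "integrable M (\<lambda>\<omega>. seen j (I \<omega>, I \<omega> * X \<omega>))"
    and "integrable M (\<lambda>\<omega>. (seen j (I \<omega>, I \<omega> * X \<omega>))\<^sup>2)"
    and "expectation (\<lambda>\<omega>. seen j (I \<omega>, I \<omega> * X \<omega>)) = pair_prob j j"
proof -
  have eq: "\<omega> \<in> space M \<Longrightarrow> seen j (I \<omega>, I \<omega> * X \<omega>) = I \<omega> $ j * I \<omega> $ j" for \<omega>
    by (simp add: seen_I I_sq)
  show "integrable M (\<lambda>\<omega>. seen j (I \<omega>, I \<omega> * X \<omega>))"
    using I_pair_int[of j j] by (simp add: eq cong: Bochner_Integration.integrable_cong)
  show "integrable M (\<lambda>\<omega>. (seen j (I \<omega>, I \<omega> * X \<omega>))\<^sup>2)"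
    using I_pair_int[of j j] by (simp add: seen_I power2_eq_square)
  show "expectation (\<lambda>\<omega>. seen j (I \<omega>, I \<omega> * X \<omega>)) = pair_prob j j"
    unfolding pair_prob_def by (simp add: eq cong: Bochner_Integration.integral_cong)
qed

lemma dev_moments:
  shows dev_sq: "integrable M (\<lambda>\<omega>. (dev j (I \<omega>, I \<omega> * X \<omega>))\<^sup>2)"
    and dev_zero: "expectation (\<lambda>\<omega>. dev j (I \<omega>, I \<omega> * X \<omega>)) = 0"
    and dev_int: "integrable M (\<lambda>\<omega>. dev j (I \<omega>, I \<omega> * X \<omega>))"
proof -
  have sq: "\<omega> \<in> space M \<Longrightarrow> (dev j (I \<omega>, I \<omega> * X \<omega>))\<^sup>2 = I \<omega> $ j * I \<omega> $ j * (X \<omega> $ j - mean $ j)\<^sup>2" for \<omega>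
    by (simp add: dev_I cent_def power2_eq_square)
  show "integrable M (\<lambda>\<omega>. (dev j (I \<omega>, I \<omega> * X \<omega>))\<^sup>2)"
    using expectation_I_pair_mult(1)[of "\<lambda>x. (x $ j - mean $ j)\<^sup>2" j j] cent_sq[of j]
    by (simp add: sq cent_def cong: Bochner_Integration.integrable_cong)
  have eq: "\<omega> \<in> space M \<Longrightarrow> dev j (I \<omega>, I \<omega> * X \<omega>) = I \<omega> $ j * I \<omega> $ j * (X \<omega> $ j - mean $ j)" for \<omega>
    by (simp add: dev_I cent_def I_sq)
  show "expectation (\<lambda>\<omega>. dev j (I \<omega>, I \<omega> * X \<omega>)) = 0"
    using expectation_I_pair_mult(2)[of "\<lambda>x. x $ j - mean $ j" j j] cent_int[of j] cent_zero[of j]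
    by (simp add: eq cent_def[abs_def] cong: Bochner_Integration.integral_cong)
  show "integrable M (\<lambda>\<omega>. dev j (I \<omega>, I \<omega> * X \<omega>))"
    using expectation_I_pair_mult(1)[of "\<lambda>x. x $ j - mean $ j" j j] cent_int[of j]
    by (simp add: eq cent_def[abs_def] cong: Bochner_Integration.integrable_cong)
qed

lemma seen_dev:
  shows "integrable M (\<lambda>\<omega>. seen j (I \<omega>, I \<omega> * X \<omega>) * dev k (I \<omega>, I \<omega> * X \<omega>))"
    and "expectation (\<lambda>\<omega>. seen j (I \<omega>, I \<omega> * X \<omega>) * dev k (I \<omega>, I \<omega> * X \<omega>)) = 0"
  using expectation_I_pair_mult[of "\<lambda>x. x $ k - mean $ k" j k] cent_int[of k] cent_zero[of k]
  by (simp_all add: seen_I dev_I cent_def[abs_def] mult.assoc)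

lemma dev_dev:
  shows "integrable M (\<lambda>\<omega>. dev j (I \<omega>, I \<omega> * X \<omega>) * dev k (I \<omega>, I \<omega> * X \<omega>))"
    and "expectation (\<lambda>\<omega>. dev j (I \<omega>, I \<omega> * X \<omega>) * dev k (I \<omega>, I \<omega> * X \<omega>)) = cov $ j $ k * pair_prob j k"
  using expectation_I_pair_mult[of "\<lambda>x. (x $ j - mean $ j) * (x $ k - mean $ k)" j k] cent_mult_int[of j k]
  by (simp_all add: seen_I dev_I cov_nth cent_def[abs_def] mult_ac)

end

section \<open>The estimators of mean and covariance\<close>

lemma S_hat_symmetric: "transpose (S_hat Is Xs n) = S_hat Is Xs n"
  by (simp add: S_hat_def Lambda_hat_def M_hat_def mat_hinv_def outer_def transpose_def vec_eq_iff
      mult.commute)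

context missing_data
begin

text \<open>
  Dividing numerator and denominator by \<open>n\<close> exhibits a ratio of empirical means; the convention
  \<open>x / 0 = 0\<close> makes the identity hold for every \<open>n\<close>.
\<close>

lemma mu_hat_nth:
  "mu_hat (\<lambda>i. Is i \<omega>) (\<lambda>i. Xs i \<omega>) n $ j = avg (\<lambda>z. snd z $ j) n \<omega> / avg (seen j) n \<omega>"
  by (cases "n = 0") (simp_all add: mu_hat_def vec_hinv_def avg_def seen_def divide_inverse)

lemma mu_ratio_moments:
  shows "integrable M (\<lambda>\<omega>. snd (I \<omega>, I \<omega> * X \<omega>) $ j)"
    and "expectation (\<lambda>\<omega>. snd (I \<omega>, I \<omega> * X \<omega>) $ j) = mean $ j * pair_prob j j"
proof -
  have eq: "snd (I \<omega>, I \<omega> * X \<omega>) $ j = dev j (I \<omega>, I \<omega> * X \<omega>) + mean $ j * seen j (I \<omega>, I \<omega> * X \<omega>)" for \<omega>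
    by (simp add: dev_def seen_def)
  show "integrable M (\<lambda>\<omega>. snd (I \<omega>, I \<omega> * X \<omega>) $ j)"
    unfolding eq using dev_int seen_single(1) by simp
  show "expectation (\<lambda>\<omega>. snd (I \<omega>, I \<omega> * X \<omega>) $ j) = mean $ j * pair_prob j j"
    unfolding eq using dev_int dev_zero seen_single by simp
qed

lemma snd_nth_meas [measurable]: "(\<lambda>z. snd z $ j) \<in> borel_measurable (borel \<Otimes>\<^sub>M borel :: ('d rvec \<times> 'd rvec) measure)"
  by measurable

lemma mu_hat_nth_tendsto:
  "AE \<omega> in M. (\<lambda>n. mu_hat (\<lambda>i. Is i \<omega>) (\<lambda>i. Xs i \<omega>) n $ j) \<longlonglongrightarrow> mean $ j"
  unfolding mu_hat_nth
  using mu_ratio_moments seen_single pair_prob_pos[of j j] by (intro ratio_tendsto) auto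

lemma mu_hat_tendsto: "AE \<omega> in M. (\<lambda>n. mu_hat (\<lambda>i. Is i \<omega>) (\<lambda>i. Xs i \<omega>) n) \<longlonglongrightarrow> mean"
proof -
  have "AE \<omega> in M. \<forall>j. (\<lambda>n. mu_hat (\<lambda>i. Is i \<omega>) (\<lambda>i. Xs i \<omega>) n $ j) \<longlonglongrightarrow> mean $ j"
    by (intro eventually_all_finite mu_hat_nth_tendsto)
  then show ?thesis by eventually_elim (auto intro: vec_tendstoI)
qed

text \<open>
  The influence function of the estimator of the mean.
\<close>

definition mu_score :: "'d rvec \<times> 'd rvec \<Rightarrow> 'd rvec" where
  "mu_score z = (\<chi> j. dev j z / pair_prob j j)"

lemma mu_hat_asymp_linear:
  "asymp_linear (\<lambda>n \<omega>. mu_hat (\<lambda>i. Is i \<omega>) (\<lambda>i. Xs i \<omega>) n) mean mu_score"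
proof (rule asymp_linear_vec)
  fix j
  have "asymp_linear (\<lambda>n \<omega>. avg (\<lambda>z. snd z $ j) n \<omega> / avg (seen j) n \<omega>) (mean $ j)
     (\<lambda>z. (snd z $ j - mean $ j * seen j z) / pair_prob j j)"
    using mu_ratio_moments seen_single pair_prob_pos[of j j] by (intro asymp_linear_ratio) auto
  then show "asymp_linear (\<lambda>n \<omega>. mu_hat (\<lambda>i. Is i \<omega>) (\<lambda>i. Xs i \<omega>) n $ j) (mean $ j) (\<lambda>z. mu_score z $ j)"
    by (simp add: mu_hat_nth mu_score_def dev_def seen_def)
qed

lemma mu_score_meas: "mu_score \<in> borel_measurable (borel \<Otimes>\<^sub>M borel)"
  unfolding mu_score_def by (rule borel_measurable_vec) simp

lemma mu_score_sq: "integrable M (\<lambda>\<omega>. (norm (mu_score (I \<omega>, I \<omega> * X \<omega>)))\<^sup>2)"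
  using dev_sq by (simp add: norm_vec_square mu_score_def power_divide)

lemma mu_score_zero: "expectation (\<lambda>\<omega>. mu_score (I \<omega>, I \<omega> * X \<omega>)) = 0"
proof -
  have "integrable M (\<lambda>\<omega>. mu_score (I \<omega>, I \<omega> * X \<omega>))"
    using dev_int by (intro integrable_vec) (simp add: mu_score_def)
  then show ?thesis
    by (simp add: vec_eq_iff integral_vec_nth) (simp add: mu_score_def dev_zero)
qed

lemma mu_error_nth:
  assumes "avg (seen j) n \<omega> \<noteq> 0"
  shows "mu_hat (\<lambda>i. Is i \<omega>) (\<lambda>i. Xs i \<omega>) n $ j - mean $ j = avg (dev j) n \<omega> / avg (seen j) n \<omega>"
proof -
  have "avg (dev j) n \<omega> = avg (\<lambda>z. snd z $ j) n \<omega> - mean $ j * avg (seen j) n \<omega>"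
    unfolding dev_def[abs_def] seen_def[abs_def] by (simp add: avg_diff avg_cmult)
  then show ?thesis using assms by (simp add: mu_hat_nth field_simps)
qed

text \<open>
  Expanding the residuals \<open>I(j) (X(j) - m(j)) = dev j - (m(j) - \<mu>(j)) seen j\<close> around the true mean separates
  the estimation error of the mean from averages of functions that do not depend on the estimator.
\<close>

lemma S_hat_nth:
  fixes j k n \<omega>
  defines "m \<equiv> mu_hat (\<lambda>i. Is i \<omega>) (\<lambda>i. Xs i \<omega>) n"
  shows "S_hat (\<lambda>i. Is i \<omega>) (\<lambda>i. Xs i \<omega>) n $ j $ k =
    (avg (\<lambda>z. dev j z * dev k z) n \<omega> - (m $ j - mean $ j) * avg (\<lambda>z. seen j z * dev k z) n \<omega>
      - (m $ k - mean $ k) * avg (\<lambda>z. seen k z * dev j z) n \<omega>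
      + (m $ j - mean $ j) * (m $ k - mean $ k) * avg (\<lambda>z. seen j z * seen k z) n \<omega>)
    / avg (\<lambda>z. seen j z * seen k z) n \<omega>"
proof -
  let ?Z = "\<lambda>i. (Is i \<omega>, Is i \<omega> * Xs i \<omega>)"
  have "(Is i \<omega> * (Xs i \<omega> - m)) $ j * (Is i \<omega> * (Xs i \<omega> - m)) $ k =
    dev j (?Z i) * dev k (?Z i) - (m $ j - mean $ j) * (seen j (?Z i) * dev k (?Z i))
      - (m $ k - mean $ k) * (seen k (?Z i) * dev j (?Z i))
      + (m $ j - mean $ j) * (m $ k - mean $ k) * (seen j (?Z i) * seen k (?Z i))" for i
    by (simp add: dev_def seen_def algebra_simps)
  then have "Lambda_hat (\<lambda>i. Is i \<omega>) (\<lambda>i. Xs i \<omega>) n $ j $ k =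
     avg (\<lambda>z. dev j z * dev k z) n \<omega> - (m $ j - mean $ j) * avg (\<lambda>z. seen j z * dev k z) n \<omega>
      - (m $ k - mean $ k) * avg (\<lambda>z. seen k z * dev j z) n \<omega>
      + (m $ j - mean $ j) * (m $ k - mean $ k) * avg (\<lambda>z. seen j z * seen k z) n \<omega>"
    by (simp add: Lambda_hat_def outer_def m_def[symmetric] avg_def sum.distrib sum_subtractf
        diff_divide_distrib add_divide_distrib flip: sum_distrib_left)
  moreover have "M_hat (\<lambda>i. Is i \<omega>) n $ j $ k = avg (\<lambda>z. seen j z * seen k z) n \<omega>"
    by (simp add: M_hat_def outer_def seen_def avg_def)
  ultimately show ?thesis by (simp add: S_hat_def mat_hinv_def divide_inverse)
qed

lemma mu_hat_meas [measurable]: "(\<lambda>\<omega>. mu_hat (\<lambda>i. Is i \<omega>) (\<lambda>i. Xs i \<omega>) n) \<in> borel_measurable M"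
  by (rule borel_measurable_vec) (simp add: mu_hat_nth)

lemma S_hat_meas [measurable]: "(\<lambda>\<omega>. S_hat (\<lambda>i. Is i \<omega>) (\<lambda>i. Xs i \<omega>) n) \<in> borel_measurable M"
  by (intro borel_measurable_vec) (simp add: S_hat_nth)

lemma S_hat_nth_tendsto:
  "AE \<omega> in M. (\<lambda>n. S_hat (\<lambda>i. Is i \<omega>) (\<lambda>i. Xs i \<omega>) n $ j $ k) \<longlonglongrightarrow> cov $ j $ k"
proof -
  have "AE \<omega> in M. (\<lambda>n. avg (\<lambda>z. dev j z * dev k z) n \<omega>) \<longlonglongrightarrow> cov $ j $ k * pair_prob j k"
    using avg_tendsto[OF _ dev_dev(1)[of j k]] by (simp add: dev_dev)
  moreover have "AE \<omega> in M. (\<lambda>n. avg (\<lambda>z. seen j z * dev k z) n \<omega>) \<longlonglongrightarrow> 0"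
    using avg_tendsto[OF _ seen_dev(1)[of j k]] by (simp add: seen_dev)
  moreover have "AE \<omega> in M. (\<lambda>n. avg (\<lambda>z. seen k z * dev j z) n \<omega>) \<longlonglongrightarrow> 0"
    using avg_tendsto[OF _ seen_dev(1)[of k j]] by (simp add: seen_dev)
  moreover have "AE \<omega> in M. (\<lambda>n. avg (\<lambda>z. seen j z * seen k z) n \<omega>) \<longlonglongrightarrow> pair_prob j k"
    using avg_tendsto[OF _ seen_pair(1)[of j k]] by (simp add: seen_pair)
  ultimately show ?thesis
    using mu_hat_nth_tendsto[of j] mu_hat_nth_tendsto[of k]
  proof eventually_elim
    case (elim \<omega>)
    have "(\<lambda>n. S_hat (\<lambda>i. Is i \<omega>) (\<lambda>i. Xs i \<omega>) n $ j $ k) \<longlonglongrightarrow>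
      (cov $ j $ k * pair_prob j k - (mean $ j - mean $ j) * 0 - (mean $ k - mean $ k) * 0
        + (mean $ j - mean $ j) * (mean $ k - mean $ k) * pair_prob j k) / pair_prob j k"
      unfolding S_hat_nth using pair_prob_pos[of j k] by (intro tendsto_intros elim) auto
    then show ?case using pair_prob_pos[of j k] by simp
  qed
qed

lemma S_hat_tendsto: "AE \<omega> in M. (\<lambda>n. S_hat (\<lambda>i. Is i \<omega>) (\<lambda>i. Xs i \<omega>) n) \<longlonglongrightarrow> cov"
proof -
  have "AE \<omega> in M. \<forall>j. \<forall>k. (\<lambda>n. S_hat (\<lambda>i. Is i \<omega>) (\<lambda>i. Xs i \<omega>) n $ j $ k) \<longlonglongrightarrow> cov $ j $ k"
    by (intro eventually_all_finite S_hat_nth_tendsto)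
  then show ?thesis by eventually_elim (auto intro!: vec_tendstoI)
qed

text \<open>
  The influence function of \<open>S_hat\<close>, and hence of \<open>Sigma_hat\<close>. It does not see that the mean is estimated,
  since the correction terms are negligible.
\<close>

definition cov_score :: "'d rvec \<times> 'd rvec \<Rightarrow> 'd rmat" where
  "cov_score z = (\<chi> j k. (dev j z * dev k z - cov $ j $ k * (seen j z * seen k z)) / pair_prob j k)"

text \<open>
  With the true mean in place of its estimate an entry is a ratio of averages, covered by
  \<open>asymp_linear_ratio\<close>. The estimated mean adds terms that contain one factor
  \<open>m(j) - \<mu>(j) = avg (dev j) / avg (seen j)\<close>, of order \<open>n\<^sup>-\<^sup>1\<^sup>/\<^sup>2\<close>, and a factor that tends to 0.
\<close>

lemma S_hat_asymp_linear:
  "asymp_linear (\<lambda>n \<omega>. S_hat (\<lambda>i. Is i \<omega>) (\<lambda>i. Xs i \<omega>) n) cov cov_score"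
proof (intro asymp_linear_vec)
  fix j k
  let ?m = "\<lambda>n \<omega>. mu_hat (\<lambda>i. Is i \<omega>) (\<lambda>i. Xs i \<omega>) n"
  let ?c = "avg (\<lambda>z. seen j z * seen k z)"
  let ?T = "\<lambda>n \<omega>. avg (\<lambda>z. dev j z * dev k z) n \<omega> / ?c n \<omega>"
  \<comment> \<open>Cofactors of \<open>avg (dev j)\<close> and \<open>avg (dev k)\<close> in the correction; the term containing the errors of both
    means is assigned to the first of them.\<close>
  define B1 where "B1 n \<omega> = ((?m n \<omega> $ k - mean $ k) * ?c n \<omega> - avg (\<lambda>z. seen j z * dev k z) n \<omega>)
     / (avg (seen j) n \<omega> * ?c n \<omega>)" for n \<omega>
  define B2 where "B2 n \<omega> = - avg (\<lambda>z. seen k z * dev j z) n \<omega> / (avg (seen k) n \<omega> * ?c n \<omega>)" for n \<omega>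
  have [measurable]: "B1 n \<in> borel_measurable M" "B2 n \<in> borel_measurable M" for n
    unfolding B1_def B2_def by measurable
  have base: "asymp_linear ?T (cov $ j $ k) (\<lambda>z. cov_score z $ j $ k)"
    unfolding cov_score_def vec_lambda_beta
    using dev_dev seen_pair seen_pair_sq pair_prob_pos[of j k] by (intro asymp_linear_ratio) auto
  have lim: "AE \<omega> in M. (\<lambda>n. avg (seen j) n \<omega>) \<longlonglongrightarrow> pair_prob j j"
    "AE \<omega> in M. (\<lambda>n. avg (seen k) n \<omega>) \<longlonglongrightarrow> pair_prob k k"
    "AE \<omega> in M. (\<lambda>n. avg (\<lambda>z. seen j z * dev k z) n \<omega>) \<longlonglongrightarrow> 0"
    "AE \<omega> in M. (\<lambda>n. avg (\<lambda>z. seen k z * dev j z) n \<omega>) \<longlonglongrightarrow> 0"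
    "AE \<omega> in M. (\<lambda>n. ?c n \<omega>) \<longlonglongrightarrow> pair_prob j k"
    using avg_tendsto[OF _ seen_single(1)] avg_tendsto[OF _ seen_dev(1)] avg_tendsto[OF _ seen_pair(1)[of j k]]
    by (simp_all add: seen_single seen_dev seen_pair)
  have pos: "pair_prob j j \<noteq> 0" "pair_prob k k \<noteq> 0" "pair_prob j k \<noteq> 0"
    using pair_prob_pos by (simp_all add: less_imp_neq[symmetric])
  have "AE \<omega> in M. (\<lambda>n. B1 n \<omega>) \<longlonglongrightarrow> 0"
    using lim mu_hat_nth_tendsto[of k]
  proof eventually_elim
    case (elim \<omega>)
    have "(\<lambda>n. B1 n \<omega>) \<longlonglongrightarrow> ((mean $ k - mean $ k) * pair_prob j k - 0) / (pair_prob j j * pair_prob j k)"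
      unfolding B1_def using pos by (intro tendsto_intros elim) auto
    then show ?case by simp
  qed
  then have s1: "small_in_prob M (\<lambda>n \<omega>. sqrt (real n) * avg (dev j) n \<omega> * B1 n \<omega>)"
    by (intro small_in_prob_sqrt_avg_mult dev_sq dev_zero) auto
  have "AE \<omega> in M. (\<lambda>n. B2 n \<omega>) \<longlonglongrightarrow> 0"
    using lim
  proof eventually_elim
    case (elim \<omega>)
    have "(\<lambda>n. B2 n \<omega>) \<longlonglongrightarrow> - 0 / (pair_prob k k * pair_prob j k)"
      unfolding B2_def using pos by (intro tendsto_intros elim) auto
    then show ?case by simp
  qed
  then have s2: "small_in_prob M (\<lambda>n \<omega>. sqrt (real n) * avg (dev k) n \<omega> * B2 n \<omega>)"
    by (intro small_in_prob_sqrt_avg_mult dev_sq dev_zero) auto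
  show "asymp_linear (\<lambda>n \<omega>. S_hat (\<lambda>i. Is i \<omega>) (\<lambda>i. Xs i \<omega>) n $ j $ k) (cov $ j $ k) (\<lambda>z. cov_score z $ j $ k)"
  proof (rule asymp_linear_perturb[OF base])
    show "small_in_prob M (\<lambda>n \<omega>. sqrt (real n) *\<^sub>R (S_hat (\<lambda>i. Is i \<omega>) (\<lambda>i. Xs i \<omega>) n $ j $ k - ?T n \<omega>))"
    proof (rule small_in_prob_eventually_eq[OF small_in_prob_add[OF s1 s2],
        where E = "\<lambda>n. {\<omega>\<in>space M. avg (seen j) n \<omega> = 0 \<or> avg (seen k) n \<omega> = 0}"])
      show "AE \<omega> in M. eventually (\<lambda>n. \<omega> \<notin> {\<omega>\<in>space M. avg (seen j) n \<omega> = 0 \<or> avg (seen k) n \<omega> = 0}) sequentially"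
        using lim(1,2)
      proof eventually_elim
        case (elim \<omega>)
        from tendsto_imp_eventually_ne[OF elim(1) pos(1)] tendsto_imp_eventually_ne[OF elim(2) pos(2)]
        show ?case by eventually_elim auto
      qed
    next
      fix n \<omega> assume "\<omega> \<in> space M" "\<omega> \<notin> {\<omega>\<in>space M. avg (seen j) n \<omega> = 0 \<or> avg (seen k) n \<omega> = 0}"
      then have nz: "avg (seen j) n \<omega> \<noteq> 0" "avg (seen k) n \<omega> \<noteq> 0" by auto
      have "S_hat (\<lambda>i. Is i \<omega>) (\<lambda>i. Xs i \<omega>) n $ j $ k - ?T n \<omega> =
        avg (dev j) n \<omega> * B1 n \<omega> + avg (dev k) n \<omega> * B2 n \<omega>"
        unfolding S_hat_nth B1_def B2_def mu_error_nth[OF nz(1)] mu_error_nth[OF nz(2)]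
        using nz by (cases "?c n \<omega> = 0") (simp, simp add: field_simps)
      then show "sqrt (real n) *\<^sub>R (S_hat (\<lambda>i. Is i \<omega>) (\<lambda>i. Xs i \<omega>) n $ j $ k - ?T n \<omega>) =
        sqrt (real n) * avg (dev j) n \<omega> * B1 n \<omega> + sqrt (real n) * avg (dev k) n \<omega> * B2 n \<omega>"
        by (simp add: algebra_simps)
    qed measurable
  qed
qed

lemma cov_score_meas: "cov_score \<in> borel_measurable (borel \<Otimes>\<^sub>M borel)"
  unfolding cov_score_def by (intro borel_measurable_vec) simp

lemma cov_score_int: "integrable M (\<lambda>\<omega>. cov_score (I \<omega>, I \<omega> * X \<omega>))"
  by (intro integrable_vec) (use dev_dev(1) seen_pair(1) in \<open>simp add: cov_score_def\<close>)

lemma cov_score_zero: "expectation (\<lambda>\<omega>. cov_score (I \<omega>, I \<omega> * X \<omega>)) = 0"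
proof -
  have "expectation (\<lambda>\<omega>. cov_score (I \<omega>, I \<omega> * X \<omega>)) $ j $ k = 0" for j k
  proof -
    have "integrable M (\<lambda>\<omega>. cov_score (I \<omega>, I \<omega> * X \<omega>) $ j)"
      using cov_score_int by (rule integrable_bounded_linear[OF bounded_linear_vec_nth])
    then have "expectation (\<lambda>\<omega>. cov_score (I \<omega>, I \<omega> * X \<omega>)) $ j $ k =
      expectation (\<lambda>\<omega>. cov_score (I \<omega>, I \<omega> * X \<omega>) $ j $ k)"
      using cov_score_int by (simp add: integral_vec_nth)
    then show ?thesis using dev_dev[of j k] seen_pair[of j k] by (simp add: cov_score_def)
  qed
  then show ?thesis by (simp add: vec_eq_iff)
qed

text \<open>
  The entries of the score are quadratic in \<open>X\<close>, so their squares are dominated by fourth powers of the norm.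
\<close>

lemma cov_score_sq:
  assumes X4: "integrable M (\<lambda>\<omega>. (norm (X \<omega>)) ^ 4)"
  shows "integrable M (\<lambda>\<omega>. (norm (cov_score (I \<omega>, I \<omega> * X \<omega>)))\<^sup>2)"
proof -
  have fourth: "(cent j \<omega> * cent k \<omega>)\<^sup>2 \<le> 8 * (norm (X \<omega>) ^ 4 + norm mean ^ 4)" for j k \<omega>
  proof -
    define u v where "u = norm (X \<omega>)" and "v = norm mean"
    have c: "\<bar>cent i \<omega>\<bar> \<le> u + v" for i
      unfolding cent_def u_def v_def
      using component_le_norm_cart[of "X \<omega>" i] component_le_norm_cart[of mean i] by linarith
    have "\<bar>cent j \<omega> * cent k \<omega>\<bar> \<le> (u + v) * (u + v)"
      unfolding abs_mult by (intro mult_mono c) (simp_all add: u_def v_def)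
    also have "\<dots> \<le> 2 * (u\<^sup>2 + v\<^sup>2)"
      using sum_squares_bound[of u v] by (simp add: power2_eq_square algebra_simps)
    finally have "\<bar>cent j \<omega> * cent k \<omega>\<bar>\<^sup>2 \<le> (2 * (u\<^sup>2 + v\<^sup>2))\<^sup>2" by (intro power_mono) auto
    also have "\<dots> \<le> 8 * (u ^ 4 + v ^ 4)"
      using sum_squares_bound[of "u\<^sup>2" "v\<^sup>2"] by (simp add: power2_eq_square power4_eq_xxxx algebra_simps)
    finally show ?thesis by (simp add: u_def v_def)
  qed
  have "integrable M (\<lambda>\<omega>. (cov_score (I \<omega>, I \<omega> * X \<omega>) $ j $ k)\<^sup>2)" for j k
  proof (rule Bochner_Integration.integrable_bound)
    define w where "w = (pair_prob j k)\<^sup>2"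
    have w: "w > 0" using pair_prob_pos[of j k] by (simp add: w_def)
    let ?b = "\<lambda>\<omega>. 2 * (8 * (norm (X \<omega>) ^ 4 + norm mean ^ 4) + (cov $ j $ k)\<^sup>2) / w"
    show "integrable M ?b" using X4 by simp
    show "AE \<omega> in M. norm ((cov_score (I \<omega>, I \<omega> * X \<omega>) $ j $ k)\<^sup>2) \<le> norm (?b \<omega>)"
    proof (rule AE_I2)
      fix \<omega> assume \<omega>: "\<omega> \<in> space M"
      let ?x = "cent j \<omega> * cent k \<omega>"
      have "cov_score (I \<omega>, I \<omega> * X \<omega>) $ j $ k = (I \<omega> $ j * I \<omega> $ k) * (?x - cov $ j $ k) / pair_prob j k"
        by (simp add: cov_score_def dev_I seen_I algebra_simps)
      then have "(cov_score (I \<omega>, I \<omega> * X \<omega>) $ j $ k)\<^sup>2 = (I \<omega> $ j * I \<omega> $ k)\<^sup>2 * (?x - cov $ j $ k)\<^sup>2 / w"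
        by (simp add: power_mult_distrib power_divide w_def)
      also have "\<dots> \<le> 1 * (?x - cov $ j $ k)\<^sup>2 / w"
        using I_01[OF \<omega>, of j] I_01[OF \<omega>, of k] w by (intro divide_right_mono mult_right_mono) auto
      also have "\<dots> \<le> 2 * (?x\<^sup>2 + (cov $ j $ k)\<^sup>2) / w"
      proof (intro divide_right_mono)
        have "0 \<le> (?x + cov $ j $ k)\<^sup>2" by simp
        then show "1 * (?x - cov $ j $ k)\<^sup>2 \<le> 2 * (?x\<^sup>2 + (cov $ j $ k)\<^sup>2)"
          by (simp only: power2_eq_square algebra_simps)
      qed (use w in simp)
      also have "\<dots> \<le> ?b \<omega>" using fourth[of j \<omega> k] w by (intro divide_right_mono) auto
      finally show "norm ((cov_score (I \<omega>, I \<omega> * X \<omega>) $ j $ k)\<^sup>2) \<le> norm (?b \<omega>)"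
        using w by simp
    qed
  qed (simp add: cov_score_def)
  then show ?thesis by (simp add: norm_vec_square)
qed

text \<open>
  The exceptional events are those where \<open>S_hat\<close> is so far from the covariance matrix that it may fail to be
  positive definite. Describing them by \<open>S_hat\<close>, a function of empirical means, and not by the square
  root makes their measurability evident.
\<close>

lemma Sigma_hat_eq_S_hat:
  assumes "pos_def cov"
  obtains E where "\<And>n. E n \<in> sets M" "AE \<omega> in M. eventually (\<lambda>n. \<omega> \<notin> E n) sequentially"
    "\<And>n \<omega>. \<omega> \<in> space M \<Longrightarrow> \<omega> \<notin> E n \<Longrightarrow>
       Sigma_hat (\<lambda>i. Is i \<omega>) (\<lambda>i. Xs i \<omega>) n = S_hat (\<lambda>i. Is i \<omega>) (\<lambda>i. Xs i \<omega>) n"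
proof -
  obtain \<delta> where \<delta>: "\<delta> > 0" "\<And>S. transpose S = S \<Longrightarrow> norm (S - cov) < \<delta> \<Longrightarrow> pos_def S"
    using pos_def_open[OF assms] by blast
  define E where "E n = {\<omega>\<in>space M. \<delta> \<le> norm (S_hat (\<lambda>i. Is i \<omega>) (\<lambda>i. Xs i \<omega>) n - cov)}" for n
  show thesis
  proof (rule that[of E])
    show "E n \<in> sets M" for n unfolding E_def by measurable
    show "AE \<omega> in M. eventually (\<lambda>n. \<omega> \<notin> E n) sequentially"
      using S_hat_tendsto
    proof eventually_elim
      case (elim \<omega>)
      from tendstoD[OF this \<delta>(1)] show ?case
        by eventually_elim (auto simp: E_def dist_norm)
    qed
    fix n \<omega> assume "\<omega> \<in> space M" "\<omega> \<notin> E n"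
    then have "pos_def (S_hat (\<lambda>i. Is i \<omega>) (\<lambda>i. Xs i \<omega>) n)"
      by (intro \<delta>(2) S_hat_symmetric) (auto simp: E_def)
    then show "Sigma_hat (\<lambda>i. Is i \<omega>) (\<lambda>i. Xs i \<omega>) n = S_hat (\<lambda>i. Is i \<omega>) (\<lambda>i. Xs i \<omega>) n"
      by (simp add: Sigma_hat_def psd_sqrt_square)
  qed
qed

lemma Sigma_hat_tendsto:
  assumes "pos_def cov"
  shows "AE \<omega> in M. (\<lambda>n. Sigma_hat (\<lambda>i. Is i \<omega>) (\<lambda>i. Xs i \<omega>) n) \<longlonglongrightarrow> cov"
proof -
  obtain E where E: "AE \<omega> in M. eventually (\<lambda>n. \<omega> \<notin> E n) sequentially"
    "\<And>n \<omega>. \<omega> \<in> space M \<Longrightarrow> \<omega> \<notin> E n \<Longrightarrow>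
       Sigma_hat (\<lambda>i. Is i \<omega>) (\<lambda>i. Xs i \<omega>) n = S_hat (\<lambda>i. Is i \<omega>) (\<lambda>i. Xs i \<omega>) n"
    using Sigma_hat_eq_S_hat[OF assms] by metis
  show ?thesis using E(1) S_hat_tendsto AE_space
  proof eventually_elim
    case (elim \<omega>)
    from elim(1) have "eventually (\<lambda>n. S_hat (\<lambda>i. Is i \<omega>) (\<lambda>i. Xs i \<omega>) n = Sigma_hat (\<lambda>i. Is i \<omega>) (\<lambda>i. Xs i \<omega>) n) sequentially"
      by eventually_elim (use E(2) elim(3) in simp)
    with elim(2) show ?case by (rule Lim_transform_eventually)
  qed
qed

lemma Sigma_hat_asymp_linear:
  assumes "pos_def cov"
  shows "asymp_linear (\<lambda>n \<omega>. Sigma_hat (\<lambda>i. Is i \<omega>) (\<lambda>i. Xs i \<omega>) n) cov cov_score"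
proof (rule Sigma_hat_eq_S_hat[OF assms])
  fix E assume "\<And>n. E n \<in> sets M" "AE \<omega> in M. eventually (\<lambda>n. \<omega> \<notin> E n) sequentially"
    "\<And>n \<omega>. \<omega> \<in> space M \<Longrightarrow> \<omega> \<notin> E n \<Longrightarrow>
       Sigma_hat (\<lambda>i. Is i \<omega>) (\<lambda>i. Xs i \<omega>) n = S_hat (\<lambda>i. Is i \<omega>) (\<lambda>i. Xs i \<omega>) n"
  then show ?thesis by (rule asymp_linear_eventually_eq[OF S_hat_asymp_linear])
qed

end

section \<open>The estimators of the missingness distribution\<close>

text \<open>
  The parameter \<open>q\<close> is written as an average over the components, although the probabilities of all components
  agree, because this average is what \<open>q_hat\<close> estimates.
\<close>

lemma iid_law_prob:
  fixes P :: "(real ^ 'd::finite) measure"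
  assumes P: "P \<in> iid_laws"
  defines "q \<equiv> (1 / real CARD('d)) * (\<Sum>j\<in>UNIV. measure P {b\<in>cube. b $ j = 1})"
  assumes a: "a \<in> cube"
  shows "measure P {a} = q ^ card {j. a $ j = 1} * (1 - q) ^ (CARD('d) - card {j. a $ j = 1})"
proof -
  interpret P: prob_space P using P by (simp add: iid_laws_def cube_laws_def)
  have sets: "sets P = sets (count_space cube)" 
    and ind: "P.indep_vars (\<lambda>_. count_space {0, 1}) (\<lambda>j a. a $ j) UNIV"
    and same: "\<And>j k. distr P (count_space {0, 1}) (\<lambda>a. a $ j) = distr P (count_space {0, 1}) (\<lambda>a. a $ k)"
    using P by (auto simp: iid_laws_def cube_laws_def)
  have space: "space P = cube" using sets_eq_imp_space_eq[OF sets] by simp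
  have nth: "(\<lambda>b. b $ j) \<in> measurable P (count_space {0, 1})" for j
    using ind by (simp add: P.indep_vars_def)
  have one: "P.prob {b\<in>cube. b $ j = 1} = P.prob {b\<in>cube. b $ k = 1}" for j k
  proof -
    have "P.prob {b\<in>cube. b $ i = 1} = measure (distr P (count_space {0, 1}) (\<lambda>a. a $ i)) {1}" for i
      by (subst measure_distr[OF nth]) (auto simp: space intro!: arg_cong[where f = P.prob])
    then show ?thesis using same[of j k] by simp
  qed
  have q: "P.prob {b\<in>cube. b $ j = 1} = q" for j
    unfolding q_def by (subst one[of _ j]) simp
  have zero: "P.prob {b\<in>cube. b $ j = 0} = 1 - q" for j
  proof -
    have "{b\<in>cube. b $ j = 0} = space P - {b\<in>cube. b $ j = 1}" by (auto simp: cube_def space)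
    moreover have "{b\<in>cube. b $ j = 1} \<in> P.events" by (auto simp: sets)
    ultimately show ?thesis by (simp add: P.prob_compl q)
  qed
  have "{a} = (\<Inter>j\<in>UNIV. (\<lambda>b. b $ j) -` {a $ j} \<inter> space P)"
    using a by (auto simp: space vec_eq_iff)
  then have "P.prob {a} = (\<Prod>j\<in>UNIV. P.prob ((\<lambda>b. b $ j) -` {a $ j} \<inter> space P))"
    using a P.indep_varsD_finite[OF ind, of "\<lambda>j. {a $ j}"] by (simp add: cube_def)
  also have "\<dots> = (\<Prod>j\<in>UNIV. if a $ j = 1 then q else 1 - q)"
  proof (rule prod.cong)
    fix j
    have "(\<lambda>b. b $ j) -` {a $ j} \<inter> space P = {b\<in>cube. b $ j = a $ j}" by (auto simp: space)
    moreover have "a $ j = 0 \<or> a $ j = 1" using a by (auto simp: cube_def)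
    ultimately show "P.prob ((\<lambda>b. b $ j) -` {a $ j} \<inter> space P) = (if a $ j = 1 then q else 1 - q)"
      using q[of j] zero[of j] by auto
  qed simp
  also have "\<dots> = q ^ card {j. a $ j = 1} * (1 - q) ^ card (UNIV - {j. a $ j = 1})"
    by (simp add: prod.If_cases Collect_neg_eq Compl_eq_Diff_UNIV)
  also have "card (UNIV - {j. a $ j = 1}) = CARD('d) - card {j. a $ j = 1}"
    by (rule card_Diff_subset) auto
  finally show ?thesis .
qed

context missing_data
begin

lemma prob_I_eq:
  assumes "a \<in> cube"
  shows "measure (distr M (count_space cube) I) {a} = prob {\<omega>\<in>space M. I \<omega> = a}"
  using assms by (subst measure_distr[OF I_cube]) (auto intro!: arg_cong[where f = prob])

lemma p_hat_freq_eq_avg: "p_hat_freq (\<lambda>i. Is i \<omega>) Xs' n a = avg (\<lambda>z. of_bool (fst z = a)) n \<omega>"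
  by (simp add: p_hat_freq_def avg_def)

definition obs_rate :: "'d rvec \<times> 'd rvec \<Rightarrow> real" where
  "obs_rate z = (1 / real CARD('d)) * (\<Sum>j\<in>UNIV. of_bool (fst z $ j = 1))"

lemma obs_rate_meas [measurable]: "obs_rate \<in> borel_measurable (borel \<Otimes>\<^sub>M borel)"
  unfolding obs_rate_def by measurable

lemma q_hat_eq_avg: "q_hat (\<lambda>i. Is i \<omega>) n = avg obs_rate n \<omega>"
  by (simp add: q_hat_def avg_def obs_rate_def)

lemma obs_rate_bounds: "0 \<le> obs_rate z" "obs_rate z \<le> 1"
proof -
  have "(\<Sum>j\<in>(UNIV::'d set). of_bool (fst z $ j = 1)) \<le> (\<Sum>j\<in>(UNIV::'d set). 1 :: real)"
    by (intro sum_mono) auto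
  then show "obs_rate z \<le> 1" by (simp add: obs_rate_def)
  show "0 \<le> obs_rate z" by (simp add: obs_rate_def sum_nonneg)
qed

lemma obs_rate_moments:
  shows "integrable M (\<lambda>\<omega>. obs_rate (I \<omega>, I \<omega> * X \<omega>))" "integrable M (\<lambda>\<omega>. (obs_rate (I \<omega>, I \<omega> * X \<omega>))\<^sup>2)"
  by (rule integrable_const_bound[of _ 1], use obs_rate_bounds in \<open>auto simp: power_le_one\<close>)+

text \<open>
  In each case the estimator has the form \<open>\<phi> (avg g)\<close>: with the identity for relative frequencies, with a
  polynomial when the components are independent and identically distributed, and with a constant
  when the distribution is known.
\<close>

lemma p_hat_estimator:
  assumes case_p: "p_hat = p_hat_known (distr M (count_space cube) I) \<or> p_hat = p_hat_freq \<or>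
      p_hat = p_hat_iid \<and> distr M (count_space cube) I \<in> iid_laws"
    and a: "a \<in> cube"
  obtains l where "l \<in> borel_measurable (borel \<Otimes>\<^sub>M borel)"
    "integrable M (\<lambda>\<omega>. (norm (l (I \<omega>, I \<omega> * X \<omega>)))\<^sup>2)"
    "expectation (\<lambda>\<omega>. l (I \<omega>, I \<omega> * X \<omega>)) = 0"
    "asymp_linear (\<lambda>n \<omega>. p_hat (\<lambda>i. Is i \<omega>) (\<lambda>i. Xs i \<omega>) n a) (prob {\<omega>\<in>space M. I \<omega> = a}) l"
    "AE \<omega> in M. (\<lambda>n. p_hat (\<lambda>i. Is i \<omega>) (\<lambda>i. Xs i \<omega>) n a) \<longlonglongrightarrow> prob {\<omega>\<in>space M. I \<omega> = a}"
proof -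
  note found = that
  define p where "p = prob {\<omega>\<in>space M. I \<omega> = a}"
  have transform: thesis
    if g [measurable]: "g \<in> borel_measurable (borel \<Otimes>\<^sub>M borel)" and \<phi>: "\<phi> \<in> borel_measurable borel"
    and D: "(\<phi> has_real_derivative D) (at q)"
    and g_int: "integrable M (\<lambda>\<omega>. g (I \<omega>, I \<omega> * X \<omega>))" "integrable M (\<lambda>\<omega>. (g (I \<omega>, I \<omega> * X \<omega>))\<^sup>2)"
    and q: "q = expectation (\<lambda>\<omega>. g (I \<omega>, I \<omega> * X \<omega>))" and p: "p = \<phi> q"
    and eq: "\<And>n \<omega>. p_hat (\<lambda>i. Is i \<omega>) (\<lambda>i. Xs i \<omega>) n a = \<phi> (avg g n \<omega>)"
    for g \<phi> D q
  proof (rule found[of "\<lambda>z. D * (g z - q)"])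
    show "(\<lambda>z. D * (g z - q)) \<in> borel_measurable (borel \<Otimes>\<^sub>M borel)" by measurable
    have "(D * (g z - q))\<^sup>2 = D\<^sup>2 * ((g z)\<^sup>2 - 2 * q * g z + q\<^sup>2)" for z
      by (simp add: power2_eq_square algebra_simps)
    then show "integrable M (\<lambda>\<omega>. (norm (D * (g (I \<omega>, I \<omega> * X \<omega>) - q)))\<^sup>2)"
      using g_int by simp
    show "expectation (\<lambda>\<omega>. D * (g (I \<omega>, I \<omega> * X \<omega>) - q)) = 0"
      using g_int by (simp add: q prob_space)
    show "asymp_linear (\<lambda>n \<omega>. p_hat (\<lambda>i. Is i \<omega>) (\<lambda>i. Xs i \<omega>) n a) (prob {\<omega>\<in>space M. I \<omega> = a}) (\<lambda>z. D * (g z - q))"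
      unfolding eq p_def[symmetric] p by (rule asymp_linear_smooth_transform[OF g \<phi> g_int(2) q D])
    show "AE \<omega> in M. (\<lambda>n. p_hat (\<lambda>i. Is i \<omega>) (\<lambda>i. Xs i \<omega>) n a) \<longlonglongrightarrow> prob {\<omega>\<in>space M. I \<omega> = a}"
      unfolding eq p_def[symmetric] p
      using avg_tendsto[OF g g_int(1), folded q]
      by eventually_elim (rule isCont_tendsto_compose[OF DERIV_isCont[OF D]])
  qed
  have freq: thesis if "p_hat = p_hat_freq"
  proof (rule transform[of "\<lambda>z. of_bool (fst z = a)" "\<lambda>x. x" 1 p])
    show "integrable M (\<lambda>\<omega>. of_bool (fst (I \<omega>, I \<omega> * X \<omega>) = a) :: real)"
      "integrable M (\<lambda>\<omega>. (of_bool (fst (I \<omega>, I \<omega> * X \<omega>) = a))\<^sup>2 :: real)"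
      by (rule integrable_const_bound[of _ 1], simp, measurable)+
    have "(\<lambda>\<omega>. of_bool (fst (I \<omega>, I \<omega> * X \<omega>) = a) :: real) = indicator {\<omega>. I \<omega> = a}"
      by (auto simp: indicator_def)
    then show "p = expectation (\<lambda>\<omega>. of_bool (fst (I \<omega>, I \<omega> * X \<omega>) = a))"
      by (simp add: p_def Int_def conj_commute)
  qed (simp_all add: that p_hat_freq_eq_avg)
  from case_p consider (known) "p_hat = p_hat_known (distr M (count_space cube) I)"
    | (freq) "p_hat = p_hat_freq" | (iid) "distr M (count_space cube) I \<in> iid_laws" "p_hat = p_hat_iid"
    by blast
  then show thesis
  proof cases
    case known
    then have "p_hat (\<lambda>i. Is i \<omega>) (\<lambda>i. Xs i \<omega>) n a = p" for n \<omega>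
      using prob_I_eq[OF a] by (simp add: p_hat_known_def p_def)
    then show ?thesis
      by (intro transform[of "\<lambda>_. 0" "\<lambda>_. p" 0 0]) simp_all
  next
    case freq
    then show ?thesis by (rule \<open>p_hat = p_hat_freq \<Longrightarrow> thesis\<close>)
  next
    case iid
    define q where "q = expectation (\<lambda>\<omega>. obs_rate (I \<omega>, I \<omega> * X \<omega>))"
    define \<phi> where "\<phi> x = x ^ card {j. a $ j = 1} * (1 - x) ^ (CARD('d) - card {j. a $ j = 1})" for x :: real
    have "measure (distr M (count_space cube) I) {b\<in>cube. b $ j = 1} = expectation (\<lambda>\<omega>. of_bool (I \<omega> $ j = 1))" for j
    proof -
      have "measure (distr M (count_space cube) I) {b\<in>cube. b $ j = 1} = prob {\<omega>\<in>space M. I \<omega> $ j = 1}"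
        using measurable_space[OF I_cube]
        by (subst measure_distr[OF I_cube]) (auto intro!: arg_cong[where f = prob])
      also have "\<dots> = expectation (indicator {\<omega>. I \<omega> $ j = 1})"
        by (simp add: Int_def conj_commute)
      also have "indicator {\<omega>. I \<omega> $ j = 1} = (\<lambda>\<omega>. of_bool (I \<omega> $ j = 1) :: real)"
        by (auto simp: indicator_def)
      finally show ?thesis .
    qed
    moreover have "integrable M (\<lambda>\<omega>. of_bool (I \<omega> $ j = 1) :: real)" for j
      by (rule integrable_const_bound[of _ 1]) (simp, measurable)
    ultimately have "(1 / real CARD('d)) * (\<Sum>j\<in>UNIV. measure (distr M (count_space cube) I) {b\<in>cube. b $ j = 1}) = q"
      by (simp add: q_def obs_rate_def del: sum_of_bool_eq)
    then have p: "p = \<phi> q"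
      using iid_law_prob[OF iid(1) a] prob_I_eq[OF a] by (simp add: p_def \<phi>_def)
    have "\<exists>D. (\<phi> has_real_derivative D) (at q)"
      unfolding \<phi>_def by (rule exI) (rule derivative_eq_intros refl)+
    then obtain D where D: "(\<phi> has_real_derivative D) (at q)" by blast
    have "\<phi> \<in> borel_measurable borel" unfolding \<phi>_def by measurable
    then show ?thesis
      using D obs_rate_moments q_def p
      by (intro transform[of obs_rate \<phi> D q]) (simp_all add: iid p_hat_iid_def \<phi>_def q_hat_eq_avg)
  qed
qed

end

section \<open>Translations of the data\<close>

text \<open>
  A component that was observed at least once has a positive denominator, which cancels against the same sum in
  the shifted numerator.
\<close>

lemma mu_hat_shift:
  fixes Is Xs :: "'d::finite sample"
  assumes cube: "\<And>i. Is i \<in> cube" and seen: "\<exists>i<n. Is i $ j = 1"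
  shows "mu_hat Is (\<lambda>i. Xs i + c) n $ j = (mu_hat Is Xs n + c) $ j"
proof -
  have nn: "0 \<le> Is i $ j" for i using cube[of i] by (auto simp: cube_def) (metis order_refl zero_le_one)
  from seen obtain i where "i < n" "Is i $ j = 1" by auto
  then have "0 < (\<Sum>i<n. Is i $ j)"
    using nn by (intro sum_pos2[of _ i]) auto
  then show ?thesis
    by (simp add: mu_hat_def vec_hinv_def algebra_simps sum.distrib flip: sum_distrib_left)
qed

text \<open>
  Where a component is observed, its mean estimate moves along with the data; where it is not, the indicator
  annihilates whatever the estimate does. So residuals are invariant even if some component
  is never observed.
\<close>

lemma residual_shift:
  fixes Is Xs :: "'d::finite sample"
  assumes cube: "\<And>i. Is i \<in> cube" and i: "i < n"
  shows "Is i * (Xs i + c - mu_hat Is (\<lambda>i. Xs i + c) n) = Is i * (Xs i - mu_hat Is Xs n)"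
proof (subst vec_eq_iff, rule allI)
  fix j
  have "Is i $ j = 0 \<or> Is i $ j = 1" using cube[of i] by (auto simp: cube_def)
  then show "(Is i * (Xs i + c - mu_hat Is (\<lambda>i. Xs i + c) n)) $ j = (Is i * (Xs i - mu_hat Is Xs n)) $ j"
  proof
    assume "Is i $ j = 1"
    then have "mu_hat Is (\<lambda>i. Xs i + c) n $ j = (mu_hat Is Xs n + c) $ j"
      using i by (intro mu_hat_shift cube) auto
    then show ?thesis by simp
  qed simp
qed

lemma Sigma_hat_shift:
  fixes Is Xs :: "'d::finite sample"
  assumes "\<And>i. Is i \<in> cube"
  shows "Sigma_hat Is (\<lambda>i. Xs i + c) n = Sigma_hat Is Xs n"
proof -
  have "(\<Sum>i<n. outer (Is i * (Xs i + c - mu_hat Is (\<lambda>i. Xs i + c) n)))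
      = (\<Sum>i<n. outer (Is i * (Xs i - mu_hat Is Xs n)))"
    by (rule sum.cong[OF refl], rule arg_cong[where f = outer], rule residual_shift[OF assms]) simp
  then show ?thesis by (simp only: Sigma_hat_def S_hat_def Lambda_hat_def)
qed

context missing_data
begin

text \<open>
  The frequency with which a component is observed has a positive limit, so almost surely every component is
  observed eventually.
\<close>

lemma mu_hat_eventually_equivariant:
  "AE \<omega> in M. \<forall>\<^sub>F n in sequentially. \<forall>c.
     mu_hat (\<lambda>i. Is i \<omega>) (\<lambda>i. Xs i \<omega> + c) n = mu_hat (\<lambda>i. Is i \<omega>) (\<lambda>i. Xs i \<omega>) n + c"
proof -
  have nz: "AE \<omega> in M. eventually (\<lambda>n. avg (seen j) n \<omega> \<noteq> 0) sequentially" for j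
    using avg_eventually_nonzero[OF seen_meas seen_single(1)[of j]] pair_prob_pos[of j j] 
    by (simp add: seen_single)
  have "AE \<omega> in M. \<forall>j. eventually (\<lambda>n. avg (seen j) n \<omega> \<noteq> 0) sequentially"
    by (intro eventually_all_finite nz)
  then show ?thesis using AE_space
  proof eventually_elim
    case (elim \<omega>)
    then have "eventually (\<lambda>n. \<forall>j. avg (seen j) n \<omega> \<noteq> 0) sequentially"
      by (intro eventually_all_finite) auto
    then show ?case
    proof eventually_elim
      case (elim n)
      have "\<exists>i<n. Is i \<omega> $ j = 1" for j
      proof (rule ccontr)
        assume "\<not> ?thesis"
        then have "\<forall>i<n. Is i \<omega> $ j = 0"
          using Is_01[OF \<open>\<omega> \<in> space M\<close>] by (auto simp: cube_def)
        then show False using elim[rule_format, of j] by (simp add: avg_def seen_def)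
      qed
      then show ?case
        using mu_hat_shift[of "\<lambda>i. Is i \<omega>"] Is_01[OF \<open>\<omega> \<in> space M\<close>] by (simp add: vec_eq_iff)
    qed
  qed
qed

end

lemma p_hat_shift:
  assumes "missingness_case \<L> p_hat"
  shows "p_hat Is Xs n a = p_hat Is Xs' n a"
  using assms by (auto simp: missingness_case_def p_hat_known_def p_hat_freq_def p_hat_iid_def)

section \<open>Consistency, linearization and behaviour under translations\<close>

theorem theorem1:
  fixes M :: "'w measure"
    and X I :: "'w \<Rightarrow> ('d::{finite,linorder}) rvec"
    and Xs Is :: "nat \<Rightarrow> 'w \<Rightarrow> 'd rvec"
    and \<mu> :: "'d rvec" and \<Sigma> :: "'d rmat" and p :: "'d rvec \<Rightarrow> real"
    and \<L> :: "('d rvec) measure set" and p_hat :: "'d p_estimator"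
  assumes M: "prob_space M"
    and d: "CARD('d) \<ge> 2"
    and X_meas: "X \<in> borel_measurable M"
    and X_sq: "integrable M (\<lambda>\<omega>. (norm (X \<omega>))\<^sup>2)"
    and mu: "\<mu> = integral\<^sup>L M X"
    and Sigma: "\<Sigma> = cov_mat M X" "pos_def \<Sigma>"
    and I_meas: "I \<in> measurable M (count_space cube)"
    and indep: "prob_space.indep_var M (count_space cube) I borel X"
    and p: "\<And>a. p a = measure M {\<omega> \<in> space M. I \<omega> = a}" "p 1 > 0"
    and Is_cube: "\<And>i. Is i \<in> measurable M (count_space cube)"
    and sample_indep: "prob_space.indep_vars M (\<lambda>_. borel \<Otimes>\<^sub>M borel)
                         (\<lambda>i \<omega>. (Is i \<omega>, Is i \<omega> * Xs i \<omega>)) UNIV"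
    and sample_distr: "\<And>i. distr M (borel \<Otimes>\<^sub>M borel) (\<lambda>\<omega>. (Is i \<omega>, Is i \<omega> * Xs i \<omega>)) =
                            distr M (borel \<Otimes>\<^sub>M borel) (\<lambda>\<omega>. (I \<omega>, I \<omega> * X \<omega>))"
    and case_p: "missingness_case \<L> p_hat"
    and law_I: "distr M (count_space cube) I \<in> \<L>"
  shows
    "(AE \<omega> in M. (\<lambda>n. mu_hat (\<lambda>i. Is i \<omega>) (\<lambda>i. Xs i \<omega>) n) \<longlonglongrightarrow> \<mu>) \<and>
     (AE \<omega> in M. (\<lambda>n. Sigma_hat (\<lambda>i. Is i \<omega>) (\<lambda>i. Xs i \<omega>) n) \<longlonglongrightarrow> \<Sigma>) \<and>
     (\<forall>a\<in>cube. AE \<omega> in M. (\<lambda>n. p_hat (\<lambda>i. Is i \<omega>) (\<lambda>i. Xs i \<omega>) n a) \<longlonglongrightarrow> p a) \<and>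
     (\<exists>(l_mu :: 'd rvec \<times> 'd rvec \<Rightarrow> 'd rvec)
       (l_Sigma :: 'd rvec \<times> 'd rvec \<Rightarrow> 'd rmat)
       (l_p :: 'd rvec \<Rightarrow> 'd rvec \<times> 'd rvec \<Rightarrow> real).
       (l_mu \<in> borel_measurable (borel \<Otimes>\<^sub>M borel) \<and>
        integrable M (\<lambda>\<omega>. (norm (l_mu (I \<omega>, I \<omega> * X \<omega>)))\<^sup>2) \<and>
        integral\<^sup>L M (\<lambda>\<omega>. l_mu (I \<omega>, I \<omega> * X \<omega>)) = 0 \<and>
        small_in_prob M (\<lambda>n \<omega>.
          sqrt (real n) *\<^sub>R (mu_hat (\<lambda>i. Is i \<omega>) (\<lambda>i. Xs i \<omega>) n - \<mu>) -
          (1 / sqrt (real n)) *\<^sub>R (\<Sum>i<n. l_mu (Is i \<omega>, Is i \<omega> * Xs i \<omega>)))) \<and>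
       (l_Sigma \<in> borel_measurable (borel \<Otimes>\<^sub>M borel) \<and>
        integrable M (\<lambda>\<omega>. l_Sigma (I \<omega>, I \<omega> * X \<omega>)) \<and>
        (integrable M (\<lambda>\<omega>. (norm (X \<omega>)) ^ 4) \<longrightarrow>
          integrable M (\<lambda>\<omega>. (norm (l_Sigma (I \<omega>, I \<omega> * X \<omega>)))\<^sup>2)) \<and>
        integral\<^sup>L M (\<lambda>\<omega>. l_Sigma (I \<omega>, I \<omega> * X \<omega>)) = 0 \<and>
        small_in_prob M (\<lambda>n \<omega>.
          sqrt (real n) *\<^sub>R (Sigma_hat (\<lambda>i. Is i \<omega>) (\<lambda>i. Xs i \<omega>) n - \<Sigma>) -
          (1 / sqrt (real n)) *\<^sub>R (\<Sum>i<n. l_Sigma (Is i \<omega>, Is i \<omega> * Xs i \<omega>)))) \<and>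
       (\<forall>a\<in>cube.
        l_p a \<in> borel_measurable (borel \<Otimes>\<^sub>M borel) \<and>
        integrable M (\<lambda>\<omega>. (norm (l_p a (I \<omega>, I \<omega> * X \<omega>)))\<^sup>2) \<and>
        integral\<^sup>L M (\<lambda>\<omega>. l_p a (I \<omega>, I \<omega> * X \<omega>)) = 0 \<and>
        small_in_prob M (\<lambda>n \<omega>.
          sqrt (real n) *\<^sub>R (p_hat (\<lambda>i. Is i \<omega>) (\<lambda>i. Xs i \<omega>) n a - p a) -
          (1 / sqrt (real n)) *\<^sub>R (\<Sum>i<n. l_p a (Is i \<omega>, Is i \<omega> * Xs i \<omega>))))) \<and>
     (\<forall>\<omega>\<in>space M. \<forall>n c j. (\<exists>i<n. Is i \<omega> $ j = 1) \<longrightarrow>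
        mu_hat (\<lambda>i. Is i \<omega>) (\<lambda>i. Xs i \<omega> + c) n $ j =
        (mu_hat (\<lambda>i. Is i \<omega>) (\<lambda>i. Xs i \<omega>) n + c) $ j) \<and>
     (AE \<omega> in M. \<forall>\<^sub>F n in sequentially. \<forall>c.
        mu_hat (\<lambda>i. Is i \<omega>) (\<lambda>i. Xs i \<omega> + c) n = mu_hat (\<lambda>i. Is i \<omega>) (\<lambda>i. Xs i \<omega>) n + c) \<and>
     (\<forall>\<omega>\<in>space M. \<forall>n c.
        Sigma_hat (\<lambda>i. Is i \<omega>) (\<lambda>i. Xs i \<omega> + c) n = Sigma_hat (\<lambda>i. Is i \<omega>) (\<lambda>i. Xs i \<omega>) n) \<and>
     (\<forall>\<omega>\<in>space M. \<forall>n c. \<forall>a\<in>cube.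
        p_hat (\<lambda>i. Is i \<omega>) (\<lambda>i. Xs i \<omega> + c) n a = p_hat (\<lambda>i. Is i \<omega>) (\<lambda>i. Xs i \<omega>) n a)"
proof -
  interpret prob_space M by (rule M)
  interpret missing_data M X I Xs Is
    by unfold_locales (use X_meas X_sq I_meas indep p Is_cube sample_indep sample_distr in auto)
  have pd: "pos_def cov" using Sigma by simp
  have estimator: "p_hat = p_hat_known (distr M (count_space cube) I) \<or> p_hat = p_hat_freq \<or>
      p_hat = p_hat_iid \<and> distr M (count_space cube) I \<in> iid_laws"
    using case_p law_I by (auto simp: missingness_case_def)
  define good where "good a l \<longleftrightarrow> l \<in> borel_measurable (borel \<Otimes>\<^sub>M borel) \<and>
      integrable M (\<lambda>\<omega>. (norm (l (I \<omega>, I \<omega> * X \<omega>)))\<^sup>2) \<and>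
      expectation (\<lambda>\<omega>. l (I \<omega>, I \<omega> * X \<omega>)) = 0 \<and>
      asymp_linear (\<lambda>n \<omega>. p_hat (\<lambda>i. Is i \<omega>) (\<lambda>i. Xs i \<omega>) n a) (p a) l \<and>
      (AE \<omega> in M. (\<lambda>n. p_hat (\<lambda>i. Is i \<omega>) (\<lambda>i. Xs i \<omega>) n a) \<longlonglongrightarrow> p a)"
    for a and l :: "'d rvec \<times> 'd rvec \<Rightarrow> real"
  have "\<exists>l. good a l" if "a \<in> cube" for a
    unfolding good_def
    by (rule p_hat_estimator[OF estimator that], unfold p(1)[symmetric]) blast
  then obtain l_p where "\<And>a. a \<in> cube \<Longrightarrow> good a (l_p a)" by metis
  note l_p = this[unfolded good_def]
  show ?thesis
  proof (intro conjI exI[of _ mu_score] exI[of _ cov_score] exI[of _ l_p] ballI allI impI)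
    show "AE \<omega> in M. (\<lambda>n. mu_hat (\<lambda>i. Is i \<omega>) (\<lambda>i. Xs i \<omega>) n) \<longlonglongrightarrow> \<mu>"
      unfolding mu by (rule mu_hat_tendsto)
    show "AE \<omega> in M. (\<lambda>n. Sigma_hat (\<lambda>i. Is i \<omega>) (\<lambda>i. Xs i \<omega>) n) \<longlonglongrightarrow> \<Sigma>"
      unfolding Sigma(1) by (rule Sigma_hat_tendsto[OF pd])
    show "small_in_prob M (\<lambda>n \<omega>. sqrt (real n) *\<^sub>R (mu_hat (\<lambda>i. Is i \<omega>) (\<lambda>i. Xs i \<omega>) n - \<mu>) -
          (1 / sqrt (real n)) *\<^sub>R (\<Sum>i<n. mu_score (Is i \<omega>, Is i \<omega> * Xs i \<omega>)))"
      using mu_hat_asymp_linear unfolding asymp_linear_def mu .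
    show "small_in_prob M (\<lambda>n \<omega>. sqrt (real n) *\<^sub>R (Sigma_hat (\<lambda>i. Is i \<omega>) (\<lambda>i. Xs i \<omega>) n - \<Sigma>) -
          (1 / sqrt (real n)) *\<^sub>R (\<Sum>i<n. cov_score (Is i \<omega>, Is i \<omega> * Xs i \<omega>)))"
      using Sigma_hat_asymp_linear[OF pd] unfolding asymp_linear_def Sigma(1) .
    show "AE \<omega> in M. \<forall>\<^sub>F n in sequentially. \<forall>c.
        mu_hat (\<lambda>i. Is i \<omega>) (\<lambda>i. Xs i \<omega> + c) n = mu_hat (\<lambda>i. Is i \<omega>) (\<lambda>i. Xs i \<omega>) n + c"
      by (rule mu_hat_eventually_equivariant)
  next
    fix a :: "'d rvec" assume "a \<in> cube"
    note l = l_p[OF this]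
    show "AE \<omega> in M. (\<lambda>n. p_hat (\<lambda>i. Is i \<omega>) (\<lambda>i. Xs i \<omega>) n a) \<longlonglongrightarrow> p a"
      "l_p a \<in> borel_measurable (borel \<Otimes>\<^sub>M borel)"
      "integrable M (\<lambda>\<omega>. (norm (l_p a (I \<omega>, I \<omega> * X \<omega>)))\<^sup>2)"
      "expectation (\<lambda>\<omega>. l_p a (I \<omega>, I \<omega> * X \<omega>)) = 0"
      using l by auto
    from l have "asymp_linear (\<lambda>n \<omega>. p_hat (\<lambda>i. Is i \<omega>) (\<lambda>i. Xs i \<omega>) n a) (p a) (l_p a)" by blast
    then show "small_in_prob M (\<lambda>n \<omega>. sqrt (real n) *\<^sub>R (p_hat (\<lambda>i. Is i \<omega>) (\<lambda>i. Xs i \<omega>) n a - p a) -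
          (1 / sqrt (real n)) *\<^sub>R (\<Sum>i<n. l_p a (Is i \<omega>, Is i \<omega> * Xs i \<omega>)))"
      unfolding asymp_linear_def .
  next
    fix \<omega> n c j assume "\<omega> \<in> space M" "\<exists>i<n. Is i \<omega> $ j = 1"
    then show "mu_hat (\<lambda>i. Is i \<omega>) (\<lambda>i. Xs i \<omega> + c) n $ j = (mu_hat (\<lambda>i. Is i \<omega>) (\<lambda>i. Xs i \<omega>) n + c) $ j"
      by (intro mu_hat_shift Is_01)
  next
    fix \<omega> n c assume "\<omega> \<in> space M"
    then show "Sigma_hat (\<lambda>i. Is i \<omega>) (\<lambda>i. Xs i \<omega> + c) n = Sigma_hat (\<lambda>i. Is i \<omega>) (\<lambda>i. Xs i \<omega>) n"
      by (intro Sigma_hat_shift Is_01)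
  qed (use mu_score_meas mu_score_sq mu_score_zero cov_score_meas cov_score_int cov_score_sq cov_score_zero
        p_hat_shift[OF case_p] in \<open>simp_all\<close>)
qed

end
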